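(* Let $(X,\mathrm{d}\mu)$ be a $\sigma$-finite measure space and let $\mathcal{Y}$ be a normed lattice. Let $T:\mathcal{Y}^d\to\mathcal{M}(X)$ be a symmetric positive multilinear operator which saturates $X$. Assume that for some $1\le q<\infty$ and some finite constant $A$ we have $$\|T(f,\dots,f)^{1/d}\|_{L^q(X)}\le A\|f\|_{\mathcal{Y}}$$ for all nonnegative $f\in\mathcal{Y}$. Assume moreover that $T$ satisfies the following structural hypothesis with a finite constant $B$: for every nonnegative $f$ in some dense subspace of $\mathcal{Y}$, there is a positive linear operator $S:\mathcal{Y}\to\mathcal{M}(X)$ (which may depend on $f$) such that for all nonnegative $h_1,\dots,h_d\in\mathcal{Y}$, $$T(h_1,\dots,h_d)(x)\le Sh_1(x)\cdots Sh_d(x)\quad\text{for a.e. }x\in X,$$ and $$Sf(x)^d\le B^d\,T(f,\dots,f)(x)\quad\text{for a.e. }x\in X.$$ Then for every nonnegative $M\in L^{q'}(X)$ with $\|M\|_{q'}=1$ there exists a positive linear operator $R:\mathcal{Y}\to L^1(X)$ such that for all nonnegative $f_1,\dots,f_d\in\mathcal{Y}$, $$M(x)^d\,T(f_1,\dots,f_d)(x)\le Rf_1(x)\cdots Rf_d(x)\quad\text{for a.e. }x\in X,$$ and $$\|R\|_{\mathcal{Y}\to L^1(X)}\le AB.$$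
   Context: Here $d$ is a positive integer. $\mathcal{M}(X)$ denotes the space of measurable functions on $X$. $q'$ is the conjugate exponent of $q$, $1/q+1/q'=1$ (so $q'=\infty$ if $q=1$). A normed lattice is a real vector lattice with a norm satisfying $\|f\|\le\|g\|$ whenever $|f|\le|g|$. A linear or multilinear operator into $\mathcal{M}(X)$ or $L^1(X)$ is positive if it maps nonnegative inputs to a.e. nonnegative functions. $T$ is symmetric if its value is unchanged under permutations of its $d$ arguments. $T$ saturates $X$ if for each subset $E\subseteq X$ of positive measure there exist a subset $E'\subseteq E$ of positive measure and nonnegative $h_1,\dots,h_d\in\mathcal{Y}$ such that $T(h_1,\dots,h_d)>0$ a.e. on $E'$.
   Formalization: The dense subspace is also required to have its nonnegative elements dense in the nonnegative elements of Y (norm density alone makes the claim false), and the constants A and B are assumed nonnegative. *)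

theory Defs
  imports "HOL-Probability.Essential_Supremum" "HOL-Library.Lattice_Algebras"
begin

class normed_lattice = real_normed_vector + ordered_real_vector + lattice_ab_group_add_abs +
  assumes norm_lattice_mono: "\<bar>f\<bar> \<le> \<bar>g\<bar> \<Longrightarrow> norm f \<le> norm g"

text \<open>
  Elements of the space of measurable functions are represented by real-valued Borel functions;
  since they are only determined up to null sets, all algebraic identities for operators hold
  almost everywhere, with an exceptional set that may depend on the arguments.
  The \<open>d\<close> arguments of a multilinear operator are indexed by a finite type \<open>'d\<close>,
  so \<open>d = CARD('d)\<close>, which is automatically positive.
\<close>

definition ae_linear :: "'x measure \<Rightarrow> ('y::real_vector \<Rightarrow> 'x \<Rightarrow> real) \<Rightarrow> bool" where
  "ae_linear \<mu> S \<longleftrightarrow>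
     (\<forall>f. S f \<in> borel_measurable \<mu>) \<and>
     (\<forall>f g. AE x in \<mu>. S (f + g) x = S f x + S g x) \<and>
     (\<forall>c f. AE x in \<mu>. S (c *\<^sub>R f) x = c * S f x)"

definition ae_multilinear ::
    "'x measure \<Rightarrow> (('d::finite \<Rightarrow> 'y::real_vector) \<Rightarrow> 'x \<Rightarrow> real) \<Rightarrow> bool" where
  "ae_multilinear \<mu> T \<longleftrightarrow> (\<forall>fs i. ae_linear \<mu> (\<lambda>f. T (fs(i := f))))"

definition ae_positive :: "'x measure \<Rightarrow> ('y::{zero,ord} \<Rightarrow> 'x \<Rightarrow> real) \<Rightarrow> bool" where
  "ae_positive \<mu> S \<longleftrightarrow> (\<forall>f. 0 \<le> f \<longrightarrow> (AE x in \<mu>. 0 \<le> S f x))"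

definition ae_multi_positive ::
    "'x measure \<Rightarrow> (('d::finite \<Rightarrow> 'y::{zero,ord}) \<Rightarrow> 'x \<Rightarrow> real) \<Rightarrow> bool" where
  "ae_multi_positive \<mu> T \<longleftrightarrow> (\<forall>fs. (\<forall>i. 0 \<le> fs i) \<longrightarrow> (AE x in \<mu>. 0 \<le> T fs x))"

definition ae_symmetric ::
    "'x measure \<Rightarrow> (('d::finite \<Rightarrow> 'y) \<Rightarrow> 'x \<Rightarrow> real) \<Rightarrow> bool" where
  "ae_symmetric \<mu> T \<longleftrightarrow> (\<forall>fs p. bij p \<longrightarrow> (AE x in \<mu>. T (fs \<circ> p) x = T fs x))"

definition saturates ::
    "'x measure \<Rightarrow> (('d::finite \<Rightarrow> 'y::{zero,ord}) \<Rightarrow> 'x \<Rightarrow> real) \<Rightarrow> bool" where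
  "saturates \<mu> T \<longleftrightarrow>
     (\<forall>E\<in>sets \<mu>. emeasure \<mu> E > 0 \<longrightarrow>
        (\<exists>E'\<in>sets \<mu>. E' \<subseteq> E \<and> emeasure \<mu> E' > 0 \<and>
           (\<exists>hs. (\<forall>i. 0 \<le> hs i) \<and> (AE x in \<mu>. x \<in> E' \<longrightarrow> T hs x > 0))))"

text \<open>
  The norm of \<open>L\<^sup>p\<close> for \<open>0 < p \<le> \<infinity>\<close>, with value \<open>\<infinity>\<close> on measurable functions outside
  \<open>L\<^sup>p\<close>. The case distinction on the integral is there because \<open>powr\<close> is only defined on reals.
\<close>

definition Lp_norm :: "ennreal \<Rightarrow> 'x measure \<Rightarrow> ('x \<Rightarrow> real) \<Rightarrow> ennreal" where
  "Lp_norm p \<mu> f =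
     (if p = \<infinity> then esssup \<mu> (\<lambda>x. ennreal \<bar>f x\<bar>)
      else let I = (\<integral>\<^sup>+ x. ennreal (\<bar>f x\<bar> powr enn2real p) \<partial>\<mu>)
           in if I = \<infinity> then \<infinity> else ennreal (enn2real I powr (1 / enn2real p)))"

definition L1_opnorm :: "'x measure \<Rightarrow> ('y::real_normed_vector \<Rightarrow> 'x \<Rightarrow> real) \<Rightarrow> ennreal" where
  "L1_opnorm \<mu> R = (SUP f\<in>{f. norm f \<le> 1}. Lp_norm 1 \<mu> (R f))"

text \<open>
  Dense subspaces in the sense appropriate to a normed lattice. Norm density alone does not make
  the nonnegative elements of \<open>D\<close> dense in the positive cone: in \<open>L\<^sup>2[0,1]\<close>, the continuous
  functions \<open>f\<close> with compact support in \<open>(0,1]\<close> and \<open>\<integral> f(x)/x dx = 0\<close> form a dense subspace whose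
  only nonnegative element is \<open>0\<close>, and a condition imposed on nonnegative elements of \<open>D\<close> would be
  void. The last conjunct excludes this; it holds for every dense vector sublattice.
\<close>

definition dense_lattice_subspace :: "'y::normed_lattice set \<Rightarrow> bool" where
  "dense_lattice_subspace D \<longleftrightarrow>
     subspace D \<and> closure D = UNIV \<and> {f. 0 \<le> f} \<subseteq> closure {f \<in> D. 0 \<le> f}"

end

theory Submission
  imports Defs "HOL-Library.Function_Algebras"
begin

text \<open>
  Put \<open>W h = M * root d (T h)\<close>. By weighted AM--GM and multilinearity, a positive linear \<open>R\<close> satisfies
  \<open>M\<^sup>d T h \<le> \<Prod> R (h i)\<close> for all nonnegative \<open>h\<close> as soon as \<open>d W h \<le> R (\<Sum> h i)\<close> for all such \<open>h\<close>,
  which is a linear condition on \<open>R\<close>. So one looks for a linear functional on \<open>\<Y>\<close>-valued functions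
  lying between the superlinear functional \<open>lower\<close> generated by the integrals \<open>\<integral>\<^sub>E d W h\<close> on
  \<open>1\<^sub>E \<Sum> h i\<close> and the sublinear functional \<open>upper F = inf {A B \<parallel>g\<parallel> | F \<le> g a.e.}\<close>. The Hahn--Banach
  sandwich theorem provides it once \<open>lower \<le> upper\<close>. For \<open>g\<close> in the dense set this inequality follows from
  integrating \<open>d W h \<le> M S (\<Sum> h i)\<close> with the operator \<open>S\<close> attached to \<open>g\<close>, since \<open>M S g \<le> B W(g,\<dots>,g)\<close>
  and \<open>\<integral> W(g,\<dots>,g) \<le> A \<parallel>g\<parallel>\<close> by Hoelder; for general \<open>g\<close> it follows by approximation. On the functions
  \<open>1\<^sub>E f\<close> the resulting functional is a finitely additive set function of \<open>E\<close>, vanishing on null sets;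
  \<open>R f\<close> is the density of its countably additive part.
\<close>

section \<open>A sandwich theorem on cones\<close>

text \<open>The functionals compared later live on nonnegative functions, so the Hahn--Banach
  argument is carried out on a convex cone, without subtracting vectors.\<close>

locale wedge =
  fixes K :: "'v::real_vector set"
  assumes zero: "0 \<in> K"
    and add: "x \<in> K \<Longrightarrow> y \<in> K \<Longrightarrow> x + y \<in> K"
    and scale: "x \<in> K \<Longrightarrow> 0 \<le> c \<Longrightarrow> c *\<^sub>R x \<in> K"
begin

definition sublinear :: "('v \<Rightarrow> real) \<Rightarrow> bool" where
  "sublinear r \<longleftrightarrow> (\<forall>x\<in>K. \<forall>y\<in>K. r (x + y) \<le> r x + r y) \<and>
     (\<forall>x\<in>K. \<forall>c>0. r (c *\<^sub>R x) = c * r x)"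

lemma sublinear_add: "sublinear r \<Longrightarrow> x \<in> K \<Longrightarrow> y \<in> K \<Longrightarrow> r (x + y) \<le> r x + r y"
  and sublinear_scale: "sublinear r \<Longrightarrow> x \<in> K \<Longrightarrow> 0 < c \<Longrightarrow> r (c *\<^sub>R x) = c * r x"
  by (auto simp: sublinear_def)

lemma sublinear_zero:
  assumes "sublinear r" shows "r 0 = 0"
  \<comment> \<open>Homogeneity is assumed for \<open>c > 0\<close>; already the factor
    \<open>2\<close> forces the value at \<open>0\<close>.\<close>
  using sublinear_scale[OF assms zero, of 2] by simp

text \<open>\<open>G\<close> is a convex cone of pairs: a vector \<open>y\<close> with a number
  \<open>v\<close> that is to bound the increment \<open>r (x + y) - r x\<close> from below. The
  last clause keeps the infimal convolution of \<open>r\<close> with \<open>G\<close> above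
  \<open>q\<close>.\<close>

definition admissible :: "('v \<Rightarrow> real) \<Rightarrow> ('v \<Rightarrow> real) \<Rightarrow> ('v \<times> real) set \<Rightarrow> bool" where
  "admissible q r G \<longleftrightarrow> (0, 0) \<in> G \<and> (\<forall>y v. (y, v) \<in> G \<longrightarrow> y \<in> K) \<and>
     (\<forall>y v z w. (y, v) \<in> G \<longrightarrow> (z, w) \<in> G \<longrightarrow> (y + z, v + w) \<in> G) \<and>
     (\<forall>y v c. (y, v) \<in> G \<longrightarrow> 0 < c \<longrightarrow> (c *\<^sub>R y, c * v) \<in> G) \<and>
     (\<forall>x\<in>K. \<forall>y v. (y, v) \<in> G \<longrightarrow> q x \<le> r (x + y) - v)"

text \<open>Closure of \<open>G\<close> under sums and positive multiples makes the infimum over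
  \<open>G\<close> subadditive and homogeneous; the pair \<open>(0, 0)\<close> puts
  \<open>r'\<close> below \<open>r\<close>.\<close>

lemma sublinear_inf_convolution:
  assumes r: "sublinear r" and adm: "admissible q r G"
  defines "r' \<equiv> \<lambda>x. INF (y, v)\<in>G. r (x + y) - v"
  shows "sublinear r'"
    and "\<And>x y v. x \<in> K \<Longrightarrow> (y, v) \<in> G \<Longrightarrow> r' x \<le> r (x + y) - v"
    and "\<And>x. x \<in> K \<Longrightarrow> q x \<le> r' x"
proof -
  have G: "\<And>y v. (y, v) \<in> G \<Longrightarrow> y \<in> K"
    and G_add: "\<And>y v z w. (y, v) \<in> G \<Longrightarrow> (z, w) \<in> G \<Longrightarrow> (y + z, v + w) \<in> G"
    and G_scale: "\<And>y v c. (y, v) \<in> G \<Longrightarrow> 0 < c \<Longrightarrow> (c *\<^sub>R y, c * v) \<in> G"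
    and G_zero: "(0, 0) \<in> G"
    and bound: "\<And>x y v. x \<in> K \<Longrightarrow> (y, v) \<in> G \<Longrightarrow> q x \<le> r (x + y) - v"
    using adm by (auto simp: admissible_def)
  have bdd: "bdd_below ((\<lambda>(y, v). r (x + y) - v) ` G)" if "x \<in> K" for x
    using bound[OF that] by (intro bdd_belowI[of _ "q x"]) auto
  show lower: "r' x \<le> r (x + y) - v" if "x \<in> K" "(y, v) \<in> G" for x y v
    unfolding r'_def using cINF_lower[OF bdd[OF that(1)] that(2)] by simp
  have greatest: "m \<le> r' x" if "\<And>y v. (y, v) \<in> G \<Longrightarrow> m \<le> r (x + y) - v" for m x
    unfolding r'_def using G_zero that by (intro cINF_greatest) auto
  show "q x \<le> r' x" if "x \<in> K" for x
    using that bound by (intro greatest)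
  have "r' (x + z) \<le> r' x + r' z" if "x \<in> K" "z \<in> K" for x z
  proof -
    \<comment> \<open>The two infima on the right are taken one after the other, with the pair
      \<open>(y2, v2)\<close> fixed first.\<close>
    have "r' (x + z) - (r (z + y2) - v2) \<le> r' x" if g2: "(y2, v2) \<in> G" for y2 v2
    proof (rule greatest)
      fix y v assume g: "(y, v) \<in> G"
      have "r' (x + z) \<le> r (x + z + (y + y2)) - (v + v2)"
        using that \<open>x \<in> K\<close> \<open>z \<in> K\<close> g g2 by (intro lower add G_add)
      also have "r (x + z + (y + y2)) \<le> r (x + y) + r (z + y2)"
        using sublinear_add[OF r, of "x + y" "z + y2"] \<open>x \<in> K\<close> \<open>z \<in> K\<close> G[OF g] G[OF g2]
        by (simp add: add algebra_simps)
      finally show "r' (x + z) - (r (z + y2) - v2) \<le> r (x + y) - v" by simp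
    qed
    then have "r' (x + z) - r' x \<le> r' z" by (intro greatest) (simp add: algebra_simps)
    then show ?thesis by simp
  qed
  moreover
  \<comment> \<open>Applied to \<open>1/c\<close> and the scaled vector, this inequality also yields
    its own converse.\<close>
  have scale_le: "c * r' x \<le> r' (c *\<^sub>R x)" if "x \<in> K" "0 < c" for x c
  proof (rule greatest)
    fix y v assume g: "(y, v) \<in> G"
    have "r' x \<le> r (x + (1/c) *\<^sub>R y) - (1/c) * v"
      using that g by (intro lower G_scale) auto
    also have "x + (1/c) *\<^sub>R y = (1/c) *\<^sub>R (c *\<^sub>R x + y)"
      using that by (simp add: algebra_simps)
    also have "r \<dots> = (1/c) * r (c *\<^sub>R x + y)"
      using that G[OF g] by (intro sublinear_scale[OF r]) (auto intro!: add scale)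
    finally show "c * r' x \<le> r (c *\<^sub>R x + y) - v"
      using that by (simp add: field_simps)
  qed
  moreover have "r' (c *\<^sub>R x) = c * r' x" if "x \<in> K" "0 < c" for x c
    using scale_le[OF that] scale_le[of "c *\<^sub>R x" "1/c"] that
    by (simp add: field_simps scale)
  ultimately show "sublinear r'" by (auto simp: sublinear_def)
qed

text \<open>Minimality is exploited through \<open>sublinear_inf_convolution\<close>: a minimal \<open>r\<close> coincides with
  every admissible infimal convolution.\<close>

lemma sandwich_minimal:
  assumes p: "sublinear p" and qp: "\<And>x. x \<in> K \<Longrightarrow> q x \<le> p x"
  obtains r where "sublinear r" "\<And>x. x \<in> K \<Longrightarrow> q x \<le> r x" "\<And>x. x \<in> K \<Longrightarrow> r x \<le> p x"
    "\<And>s x. \<lbrakk>sublinear s; \<And>x. x \<in> K \<Longrightarrow> q x \<le> s x; \<And>x. x \<in> K \<Longrightarrow> s x \<le> r x; x \<in> K\<rbrakk> \<Longrightarrow> s x = r x"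
proof -
  \<comment> \<open>Values off \<open>K\<close> are fixed to \<open>0\<close>, so that the order on
    whole functions compares them on \<open>K\<close> alone and a minimal element of \<A> is minimal
    on \<open>K\<close>.\<close>
  define \<A> where "\<A> = {r. sublinear r \<and> (\<forall>x\<in>K. q x \<le> r x \<and> r x \<le> p x) \<and> (\<forall>x. x \<notin> K \<longrightarrow> r x = 0)}"
  let ?p = "\<lambda>x. if x \<in> K then p x else 0"
  have p_in: "?p \<in> \<A>"
    using p qp by (auto simp: \<A>_def sublinear_def add scale)
  have "\<exists>m\<in>\<A>. \<forall>a\<in>\<A>. a \<le> m \<longrightarrow> a = m"
  proof (rule predicate_Zorn[of \<A> "\<lambda>r s. s \<le> r", simplified])
    show "partial_order_on \<A> (relation_of (\<lambda>r s. s \<le> r) \<A>)"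
      by (rule partial_order_on_relation_ofI) auto
    fix C assume C: "C \<in> Chains (relation_of (\<lambda>r s. s \<le> r) \<A>)"
    then have CA: "C \<subseteq> \<A>" and chain: "\<And>r s. r \<in> C \<Longrightarrow> s \<in> C \<Longrightarrow> r \<le> s \<or> s \<le> r"
      by (auto simp: Chains_def relation_of_def)
    show "\<exists>u\<in>\<A>. \<forall>a\<in>C. u \<le> a"
    proof (cases "C = {}")
      case True with p_in show ?thesis by blast
    next
      case False
      define u where "u x = (INF r\<in>C. r x)" for x
      have bdd: "bdd_below ((\<lambda>r. r x) ` C)" for x
        using CA by (cases "x \<in> K")
          (auto simp: \<A>_def subset_iff intro!: bdd_belowI[of _ "if x \<in> K then q x else 0"])
      have lower: "u x \<le> r x" if "r \<in> C" for r x
        unfolding u_def using bdd that by (rule cINF_lower)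
      have greatest: "m \<le> u x" if "\<And>r. r \<in> C \<Longrightarrow> m \<le> r x" for m x
        unfolding u_def using False that by (intro cINF_greatest) auto
      have CA': "sublinear r" "x \<in> K \<Longrightarrow> q x \<le> r x" "x \<in> K \<Longrightarrow> r x \<le> p x" "x \<notin> K \<Longrightarrow> r x = 0"
        if "r \<in> C" for r x
        using CA that by (auto simp: \<A>_def)
      have "u (x + y) \<le> u x + u y" if "x \<in> K" "y \<in> K" for x y
      proof -
        \<comment> \<open>In a chain \<open>r\<close> and \<open>s\<close> are comparable, and the
          smaller one bounds \<open>u (x + y)\<close> through its own subadditivity.\<close>
        have *: "u (x + y) \<le> r x + s y" if "r \<in> C" "s \<in> C" for r s
          using chain[OF that]
        proof
          assume "r \<le> s"
          then show ?thesis
            using lower[OF that(1), of "x + y"] sublinear_add[OF CA'(1)[OF that(1)] \<open>x \<in> K\<close> \<open>y \<in> K\<close>]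
            by (auto dest: le_funD[where x = y])
        next
          assume "s \<le> r"
          then show ?thesis
            using lower[OF that(2), of "x + y"] sublinear_add[OF CA'(1)[OF that(2)] \<open>x \<in> K\<close> \<open>y \<in> K\<close>]
            by (auto dest: le_funD[where x = x])
        qed
        have "u (x + y) - s y \<le> u x" if "s \<in> C" for s
          using *[OF _ that] by (intro greatest) (simp add: algebra_simps)
        then have "u (x + y) - u x \<le> u y" by (intro greatest) (simp add: algebra_simps)
        then show ?thesis by simp
      qed
      moreover have scale_le: "c * u x \<le> u (c *\<^sub>R x)" if "x \<in> K" "0 < c" for x c
        using that by (intro greatest) (simp add: sublinear_scale[OF CA'(1)] lower)
      moreover have "u (c *\<^sub>R x) = c * u x" if "x \<in> K" "0 < c" for x c
        using scale_le[OF that] scale_le[of "c *\<^sub>R x" "1/c"] that by (simp add: field_simps scale)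
      moreover have "q x \<le> u x" if "x \<in> K" for x
        using that by (intro greatest CA')
      moreover have "u x \<le> p x" if "x \<in> K" for x
        using False lower CA'(3)[OF _ that] by (meson ex_in_conv order.trans)
      moreover have "u x = 0" if "x \<notin> K" for x
        using False lower[of _ x] greatest[of 0 x] CA'(4)[OF _ that]
        by (metis all_not_in_conv order_antisym order_refl)
      ultimately have "u \<in> \<A>" by (auto simp: \<A>_def sublinear_def)
      then show ?thesis using lower by (auto simp: le_fun_def)
    qed
  qed
  then obtain r where r: "r \<in> \<A>" and min: "\<And>a. a \<in> \<A> \<Longrightarrow> a \<le> r \<Longrightarrow> a = r" by blast
  show ?thesis
  proof (rule that[of r])
    fix s x assume s: "sublinear s" "\<And>x. x \<in> K \<Longrightarrow> q x \<le> s x" "\<And>x. x \<in> K \<Longrightarrow> s x \<le> r x" "x \<in> K"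
    let ?s = "\<lambda>x. if x \<in> K then s x else 0"
    have "sublinear ?s" using s(1) by (simp add: sublinear_def add scale)
    then have "?s \<in> \<A>" "?s \<le> r"
      using s r by (auto simp: \<A>_def le_fun_def intro: order.trans)
    then have "?s = r" by (rule min)
    then show "s x = r x" using \<open>x \<in> K\<close> by (auto dest: fun_cong[where x = x])
  qed (use r in \<open>auto simp: \<A>_def\<close>)
qed

text \<open>A minimal \<open>r\<close> is additive. Two admissible sets are used in turn: the first
  gives \<open>r x + q y \<le> r (x + y)\<close>, and this estimate makes the second one admissible,
  which improves \<open>q y\<close> to \<open>r y\<close>.\<close>

theorem sandwich:
  assumes p: "sublinear p" and q: "sublinear (\<lambda>x. - q x)" and qp: "\<And>x. x \<in> K \<Longrightarrow> q x \<le> p x"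
  obtains \<phi> where "\<And>x y. x \<in> K \<Longrightarrow> y \<in> K \<Longrightarrow> \<phi> (x + y) = \<phi> x + \<phi> y"
    "\<And>x c. x \<in> K \<Longrightarrow> 0 < c \<Longrightarrow> \<phi> (c *\<^sub>R x) = c * \<phi> x"
    "\<And>x. x \<in> K \<Longrightarrow> q x \<le> \<phi> x" "\<And>x. x \<in> K \<Longrightarrow> \<phi> x \<le> p x"
proof -
  obtain r where r: "sublinear r" "\<And>x. x \<in> K \<Longrightarrow> q x \<le> r x" "\<And>x. x \<in> K \<Longrightarrow> r x \<le> p x"
    and min: "\<And>s x. \<lbrakk>sublinear s; \<And>x. x \<in> K \<Longrightarrow> q x \<le> s x; \<And>x. x \<in> K \<Longrightarrow> s x \<le> r x; x \<in> K\<rbrakk> \<Longrightarrow> s x = r x"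
    using sandwich_minimal[OF p qp] by blast
  \<comment> \<open>By minimality the convolution with an admissible \<open>G\<close> equals
    \<open>r\<close>, so every pair in \<open>G\<close> bounds the increments of \<open>r\<close>
    from below.\<close>
  have below: "r x \<le> r (x + y) - v" if adm: "admissible q r G" and "x \<in> K" "(y, v) \<in> G" for G x y v
  proof -
    note conv = sublinear_inf_convolution[OF r(1) adm]
    have "(0, 0) \<in> G" using adm by (simp add: admissible_def)
    then have "(INF (y, v)\<in>G. r (x + y) - v) = r x"
      using conv(2)[of _ 0 0] \<open>x \<in> K\<close> by (intro min conv(1) conv(3)) auto
    then show ?thesis using conv(2)[OF that(2,3)] by simp
  qed
  have q_add: "q x + q y \<le> q (x + y)" if "x \<in> K" "y \<in> K" for x y
    using sublinear_add[OF q that] by simp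
  have q_scale: "q (c *\<^sub>R x) = c * q x" if "x \<in> K" "0 < c" for x c
    using sublinear_scale[OF q that] by simp
  have q_zero: "q 0 = 0" using sublinear_zero[OF q] by simp
  have r_q: "r x + q y \<le> r (x + y)" if "x \<in> K" "y \<in> K" for x y
  proof -
    have "q x \<le> r (x + y) - v" if "x \<in> K" "y \<in> K" "v \<le> q y" for x y v
      using r(2)[of "x + y"] q_add[of x y] add that by fastforce
    moreover have "v + w \<le> q (y + z)" if "y \<in> K" "z \<in> K" "v \<le> q y" "w \<le> q z" for y z v w
      using q_add[of y z] that by linarith
    \<comment> \<open>All \<open>v \<le> q y\<close> are taken, because the graph of a superlinear
      \<open>q\<close> need not be closed under addition.\<close>
    ultimately have "admissible q r {(y, v). y \<in> K \<and> v \<le> q y}"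
      by (auto simp: admissible_def add scale zero q_zero q_scale)
    then have "r x \<le> r (x + y) - q y"
      by (rule below) (use that in auto)
    then show ?thesis by simp
  qed
  have "r (x + y) = r x + r y" if "x \<in> K" "y \<in> K" for x y
  proof -
    \<comment> \<open>The ray through \<open>y\<close>, carrying the values of \<open>r\<close>
      itself.\<close>
    define G where "G = {(t *\<^sub>R y, t * r y) | t. 0 \<le> t}"
    have mem: "(t *\<^sub>R y, t * r y) \<in> G" if "0 \<le> t" for t
      using that by (auto simp: G_def)
    have cases: "\<exists>t\<ge>0. z = t *\<^sub>R y \<and> v = t * r y" if "(z, v) \<in> G" for z v
      using that by (auto simp: G_def)
    have r_scale: "r (t *\<^sub>R y) = t * r y" if "0 \<le> t" for t
      using that sublinear_scale[OF r(1) \<open>y \<in> K\<close>, of t] sublinear_zero[OF r(1)] by (cases "t = 0") auto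
    have "q x \<le> r (x + z) - v" if "x \<in> K" "(z, v) \<in> G" for x z v
      using cases[OF that(2)] r_q[OF scale[OF \<open>y \<in> K\<close>] that(1)] that \<open>y \<in> K\<close>
      by (auto simp: r_scale add.commute algebra_simps)
    moreover have "(a + z, v + w) \<in> G" if "(a, v) \<in> G" "(z, w) \<in> G" for a v z w
      using cases[OF that(1)] cases[OF that(2)] mem
      by (metis add_nonneg_nonneg distrib_right scaleR_add_left)
    moreover have "(c *\<^sub>R z, c * v) \<in> G" if "(z, v) \<in> G" "0 < c" for z v c
      using cases[OF that(1)] mem[of "c * _"] \<open>0 < c\<close> by (auto simp: mult.assoc)
    moreover have "z \<in> K" if "(z, v) \<in> G" for z v
      using cases[OF that] \<open>y \<in> K\<close> scale by auto
    ultimately have "admissible q r G"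
      using mem[of 0] unfolding admissible_def by auto
    then have "r x \<le> r (x + y) - r y"
      using \<open>x \<in> K\<close> mem[of 1] by (intro below[where G = G]) auto
    then show ?thesis using sublinear_add[OF r(1) that] by simp
  qed
  then show ?thesis
    using that[of r] r sublinear_scale[OF r(1)] by blast
qed

end

section \<open>The countably additive part of a finitely additive set function\<close>

text \<open>For a finitely additive set function \<open>\<nu>\<close>, this is its countably additive part in the
  Yosida--Hewitt decomposition.\<close>

definition sigma_part :: "'a measure \<Rightarrow> ('a set \<Rightarrow> ennreal) \<Rightarrow> 'a measure" where
  "sigma_part M \<nu> = measure_of (space M) (sets M) (outer_measure (sets M) \<nu>)"

lemma sets_sigma_part [simp]: "sets (sigma_part M \<nu>) = sets M"
  and space_sigma_part [simp]: "space (sigma_part M \<nu>) = space M"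
  by (simp_all add: sigma_part_def)

text \<open>Caratheodory's argument: finite additivity already puts every set of the algebra into
  the lambda system of the outer measure. So the outer measure is countably additive on
  \<open>sets M\<close>; it may only be smaller than \<nu>.\<close>

lemma emeasure_sigma_part:
  assumes "positive (sets M) \<nu>" "additive (sets M) \<nu>" and E: "E \<in> sets M"
  shows "emeasure (sigma_part M \<nu>) E = outer_measure (sets M) \<nu> E"
proof -
  have inc: "increasing (sets M) \<nu>"
    by (rule sets.additive_increasing) fact+
  have "measure_space (space M) (lambda_system (space M) (Pow (space M)) (outer_measure (sets M) \<nu>))
      (outer_measure (sets M) \<nu>)"
    by (intro sigma_algebra.caratheodory_lemma[OF sigma_algebra_Pow]
        sets.outer_measure_space_outer_measure assms inc)
  then have "measure_space (space M) (sets M) (outer_measure (sets M) \<nu>)"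
    by (rule measure_down) (intro sets.sigma_algebra_axioms
        sets.algebra_subset_lambda_system assms inc)+
  then show ?thesis
    unfolding sigma_part_def using E
    by (intro emeasure_measure_of_sigma) (auto simp: measure_space_def)
qed

lemma emeasure_sigma_part_le:
  assumes \<nu>: "positive (sets M) \<nu>" "additive (sets M) \<nu>"
    and A: "range A \<subseteq> sets M" "E \<subseteq> (\<Union>i. A i)" and E: "E \<in> sets M"
  shows "emeasure (sigma_part M \<nu>) E \<le> (\<Sum>i. \<nu> (A i))"
  using sets.outer_measure_le[OF \<nu>(1) sets.additive_increasing[OF \<nu>] A] emeasure_sigma_part[OF \<nu> E] by simp

lemma emeasure_sigma_part_le_self:
  assumes \<nu>: "positive (sets M) \<nu>" "additive (sets M) \<nu>" and E: "E \<in> sets M"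
  shows "emeasure (sigma_part M \<nu>) E \<le> \<nu> E"
proof -
  have "emeasure (sigma_part M \<nu>) E \<le> (\<Sum>i::nat. \<nu> (if i = 0 then E else {}))"
    by (rule emeasure_sigma_part_le[OF \<nu>]) (use E in auto)
  also have "\<dots> = \<nu> E"
    using positiveD1[OF \<nu>(1)] by (subst suminf_finite[of "{0}"]) auto
  finally show ?thesis .
qed

text \<open>Countable subadditivity bounds \<open>N\<close> by the sum over any cover. Through this
  maximality a measure below \<nu> stays below the countably additive part.\<close>

lemma sigma_part_greatest:
  assumes \<nu>: "positive (sets M) \<nu>" "additive (sets M) \<nu>" and E: "E \<in> sets M"
    and N: "sets N = sets M" "\<And>A. A \<in> sets M \<Longrightarrow> emeasure N A \<le> \<nu> A"
  shows "emeasure N E \<le> emeasure (sigma_part M \<nu>) E"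
  unfolding emeasure_sigma_part[OF \<nu> E] outer_measure_def
proof (safe intro!: INF_greatest)
  fix A :: "nat \<Rightarrow> 'a set" assume A: "range A \<subseteq> sets M" "E \<subseteq> (\<Union>i. A i)"
  have "emeasure N E \<le> emeasure N (\<Union>i. A i)"
    using A N(1) by (intro emeasure_mono) auto
  also have "\<dots> \<le> (\<Sum>i. emeasure N (A i))"
    using A N(1) by (intro emeasure_subadditive_countably) auto
  also have "\<dots> \<le> (\<Sum>i. \<nu> (A i))"
    using A N(2) by (intro suminf_le) auto
  finally show "emeasure N E \<le> (\<Sum>i. \<nu> (A i))" .
qed

lemma suminf_additive_le:
  fixes \<nu> :: "'a set \<Rightarrow> ennreal"
  assumes \<nu>: "positive (sets M) \<nu>" "additive (sets M) \<nu>"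
    and A: "range A \<subseteq> sets M" "disjoint_family A" "\<And>i. A i \<subseteq> E" and E: "E \<in> sets M"
  shows "(\<Sum>i. \<nu> (A i)) \<le> \<nu> E"
proof (rule suminf_le_const[OF summableI])
  fix n :: nat
  have "(\<Sum>i<n. \<nu> (A i)) = \<nu> (\<Union>i<n. A i)"
    using A by (intro sets.additive_sum[OF \<nu>]) (auto simp: disjoint_family_on_def)
  also have "\<dots> \<le> \<nu> E"
    using A E by (intro increasingD[OF sets.additive_increasing[OF \<nu>]]) auto
  finally show "(\<Sum>i<n. \<nu> (A i)) \<le> \<nu> E" .
qed

text \<open>Addition of \<open>c\<close> is continuous and monotone, hence commutes with the
  infimum; \<open>c\<close> may be infinite and cannot simply be subtracted.\<close>

lemma le_add_INF_ennreal:
  fixes f :: "'i \<Rightarrow> ennreal"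
  assumes "I \<noteq> {}" and "\<And>i. i \<in> I \<Longrightarrow> x \<le> c + f i"
  shows "x \<le> c + (INF i\<in>I. f i)"
proof -
  have "c + Inf (f ` I) = (INF y\<in>f ` I. c + y)"
    using assms(1) continuous_add[of "at_right (Inf (f ` I))" "\<lambda>x. c" "\<lambda>x. x"]
    by (intro continuous_at_Inf_mono) (auto simp: mono_def)
  then show ?thesis using assms(2) by (auto intro!: INF_greatest)
qed

text \<open>For \<open>\<le>\<close> the two set functions call for different covers. They are
  introduced one at a time: \<open>half\<close> covers for \<rho> only, and is then applied on the
  pieces of a cover chosen for \<nu>. For \<open>\<ge>\<close> a single cover serves both.\<close>

lemma emeasure_sigma_part_add:
  assumes \<nu>: "positive (sets M) \<nu>" "additive (sets M) \<nu>"
    and \<rho>: "positive (sets M) \<rho>" "additive (sets M) \<rho>" and E: "E \<in> sets M"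
  shows "emeasure (sigma_part M (\<lambda>A. \<nu> A + \<rho> A)) E =
    emeasure (sigma_part M \<nu>) E + emeasure (sigma_part M \<rho>) E"
proof (rule antisym)
  have sum: "positive (sets M) (\<lambda>A. \<nu> A + \<rho> A)" "additive (sets M) (\<lambda>A. \<nu> A + \<rho> A)"
    using \<nu> \<rho> by (auto simp: positive_def additive_def ac_simps)
  let ?m = "emeasure (sigma_part M (\<lambda>A. \<nu> A + \<rho> A))"
  have half: "?m E \<le> \<nu> E + emeasure (sigma_part M \<rho>) E" if E: "E \<in> sets M" for E
  proof -
    have "?m E \<le> \<nu> E + (\<Sum>i. \<rho> (B i))"
      if B: "range B \<subseteq> sets M" "disjoint_family B" "E \<subseteq> (\<Union>i. B i)" for B :: "nat \<Rightarrow> 'a set"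
    proof -
      have "?m E \<le> (\<Sum>i. \<nu> (E \<inter> B i) + \<rho> (E \<inter> B i))"
        using B E by (intro emeasure_sigma_part_le[OF sum]) auto
      also have "\<dots> = (\<Sum>i. \<nu> (E \<inter> B i)) + (\<Sum>i. \<rho> (E \<inter> B i))"
        by (rule suminf_add[symmetric]) (auto intro: summableI)
      \<comment> \<open>Here the cover has to be disjoint: finite additivity then keeps every
        partial sum below \<open>\<nu> E\<close>.\<close>
      also have "(\<Sum>i. \<nu> (E \<inter> B i)) \<le> \<nu> E"
        using B E by (intro suminf_additive_le[OF \<nu>]) (auto simp: disjoint_family_on_def)
      also have "(\<Sum>i. \<rho> (E \<inter> B i)) \<le> (\<Sum>i. \<rho> (B i))"
        using B E by (intro suminf_le increasingD[OF sets.additive_increasing[OF \<rho>]]) auto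
      finally show ?thesis by (simp add: add_mono)
    qed
    then show ?thesis
      unfolding emeasure_sigma_part[OF \<rho> E] outer_measure_def
      using E by (intro le_add_INF_ennreal)
        (auto intro!: exI[of _ "\<lambda>i. if i = 0 then E else {}"] simp: disjoint_family_on_def split: if_splits)
  qed
  have "?m E \<le> (\<Sum>i. \<nu> (A i)) + emeasure (sigma_part M \<rho>) E"
    if A: "range A \<subseteq> sets M" "disjoint_family A" "E \<subseteq> (\<Union>i. A i)" for A :: "nat \<Rightarrow> 'a set"
  proof -
    have E_eq: "E = (\<Union>i. E \<inter> A i)" using A by auto
    have disj: "disjoint_family (\<lambda>i. E \<inter> A i)" using A by (auto simp: disjoint_family_on_def)
    \<comment> \<open>Both sigma parts are countably additive on the pieces, so \<open>half\<close>
      can be summed and the contribution of \<rho> adds up to its exact value on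
      \<open>E\<close>.\<close>
    have "?m E = (\<Sum>i. ?m (E \<inter> A i))"
      using A E by (subst E_eq, intro suminf_emeasure[symmetric] disj) auto
    also have "\<dots> \<le> (\<Sum>i. \<nu> (E \<inter> A i) + emeasure (sigma_part M \<rho>) (E \<inter> A i))"
      using A E by (intro suminf_le half) auto
    also have "\<dots> = (\<Sum>i. \<nu> (E \<inter> A i)) + (\<Sum>i. emeasure (sigma_part M \<rho>) (E \<inter> A i))"
      by (rule suminf_add[symmetric]) (auto intro: summableI)
    also have "(\<Sum>i. emeasure (sigma_part M \<rho>) (E \<inter> A i)) = emeasure (sigma_part M \<rho>) E"
      using A E by (subst (2) E_eq, intro suminf_emeasure disj) auto
    also have "(\<Sum>i. \<nu> (E \<inter> A i)) \<le> (\<Sum>i. \<nu> (A i))"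
      using A E by (intro suminf_le increasingD[OF sets.additive_increasing[OF \<nu>]]) auto
    finally show ?thesis by (simp add: add_mono)
  qed
  then have "?m E \<le> emeasure (sigma_part M \<rho>) E + emeasure (sigma_part M \<nu>) E"
    unfolding emeasure_sigma_part[OF \<nu> E] outer_measure_def
    using E by (intro le_add_INF_ennreal)
      (auto intro!: exI[of _ "\<lambda>i. if i = 0 then E else {}"] simp: disjoint_family_on_def add.commute split: if_splits)
  then show "?m E \<le> emeasure (sigma_part M \<nu>) E + emeasure (sigma_part M \<rho>) E"
    by (simp add: add.commute)
  show "emeasure (sigma_part M \<nu>) E + emeasure (sigma_part M \<rho>) E \<le> ?m E"
    unfolding emeasure_sigma_part[OF sum E] outer_measure_def
  proof (safe intro!: INF_greatest)
    fix A :: "nat \<Rightarrow> 'a set" assume A: "range A \<subseteq> sets M" "E \<subseteq> (\<Union>i. A i)"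
    have "emeasure (sigma_part M \<nu>) E + emeasure (sigma_part M \<rho>) E \<le> (\<Sum>i. \<nu> (A i)) + (\<Sum>i. \<rho> (A i))"
      using A E \<nu> \<rho> by (intro add_mono emeasure_sigma_part_le)
    also have "\<dots> = (\<Sum>i. \<nu> (A i) + \<rho> (A i))"
      by (rule suminf_add) (auto intro: summableI)
    finally show "emeasure (sigma_part M \<nu>) E + emeasure (sigma_part M \<rho>) E \<le> \<dots>" .
  qed
qed

lemma sigma_part_cong:
  assumes "\<And>A. A \<in> sets M \<Longrightarrow> \<nu> A = \<rho> A"
  shows "sigma_part M \<nu> = sigma_part M \<rho>"
  unfolding sigma_part_def
  by (intro measure_of_eq sets.space_closed)
    (auto simp: outer_measure_def assms sets.sigma_sets_eq intro!: INF_cong suminf_cong)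

text \<open>Maximality gives one inequality, since a multiple of the countably additive part is a
  measure below the same multiple of \<nu>; the other is that inequality for
  \<open>1/c\<close>.\<close>

lemma emeasure_sigma_part_cmult:
  assumes \<nu>: "positive (sets M) \<nu>" "additive (sets M) \<nu>"
    and E: "E \<in> sets M" and c: "0 < c"
  shows "emeasure (sigma_part M (\<lambda>A. ennreal c * \<nu> A)) E = ennreal c * emeasure (sigma_part M \<nu>) E"
proof -
  have scaled: "positive (sets M) (\<lambda>A. ennreal c * \<nu> A)" "additive (sets M) (\<lambda>A. ennreal c * \<nu> A)"
    if "positive (sets M) \<nu>" "additive (sets M) \<nu>" for c \<nu>
    using that by (auto simp: positive_def additive_def distrib_left)
  have le: "ennreal c * emeasure (sigma_part M \<nu>) E \<le> emeasure (sigma_part M (\<lambda>A. ennreal c * \<nu> A)) E"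
    if \<nu>: "positive (sets M) \<nu>" "additive (sets M) \<nu>" for c \<nu>
    using sigma_part_greatest[OF scaled[OF \<nu>, of c] E, of "scale_measure (ennreal c) (sigma_part M \<nu>)"]
      emeasure_sigma_part_le_self[OF \<nu>] by (simp add: mult_left_mono)
  have "ennreal (1/c) * emeasure (sigma_part M (\<lambda>A. ennreal c * \<nu> A)) E
      \<le> emeasure (sigma_part M (\<lambda>A. ennreal (1/c) * (ennreal c * \<nu> A))) E"
    by (intro le scaled \<nu>)
  then have "ennreal (1/c) * emeasure (sigma_part M (\<lambda>A. ennreal c * \<nu> A)) E \<le> emeasure (sigma_part M \<nu>) E"
    using c by (simp flip: mult.assoc ennreal_mult')
  then have "ennreal c * (ennreal (1/c) * emeasure (sigma_part M (\<lambda>A. ennreal c * \<nu> A)) E)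
      \<le> ennreal c * emeasure (sigma_part M \<nu>) E"
    by (intro mult_left_mono) auto
  then show ?thesis
    using c le[OF \<nu>] by (intro antisym) (simp_all flip: mult.assoc ennreal_mult')
qed

text \<open>Lying below \<nu>, the countably additive part inherits finiteness and absolute
  continuity, so Radon--Nikodym applies. Finite mass makes the density finite a.e., and
  \<open>enn2real\<close> changes it on a null set only.\<close>

lemma sigma_part_density:
  assumes "sigma_finite_measure M"
    and \<nu>: "positive (sets M) \<nu>" "additive (sets M) \<nu>" "\<nu> (space M) < \<infinity>"
    and null: "\<And>E. E \<in> null_sets M \<Longrightarrow> \<nu> E = 0"
  obtains r :: "'a \<Rightarrow> real" where "integrable M r" "\<And>x. 0 \<le> r x"
    "\<And>E. E \<in> sets M \<Longrightarrow> emeasure (sigma_part M \<nu>) E = (\<integral>\<^sup>+x\<in>E. r x \<partial>M)"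
proof -
  interpret sigma_finite_measure M by fact
  have fin: "emeasure (sigma_part M \<nu>) (space M) < \<infinity>"
    using emeasure_sigma_part_le_self[OF \<nu>(1,2) sets.top] \<nu>(3) by (rule le_less_trans)
  have "absolutely_continuous M (sigma_part M \<nu>)"
    unfolding absolutely_continuous_def
  proof
    fix E assume E: "E \<in> null_sets M"
    then show "E \<in> null_sets (sigma_part M \<nu>)"
      using emeasure_sigma_part_le_self[OF \<nu>(1,2), of E] null[OF E] by (auto simp: null_sets_def)
  qed
  then obtain g where g [measurable]: "g \<in> borel_measurable M" and dens: "density M g = sigma_part M \<nu>"
    using Radon_Nikodym[of "sigma_part M \<nu>"] by auto
  have eq: "emeasure (sigma_part M \<nu>) E = (\<integral>\<^sup>+x\<in>E. g x \<partial>M)" if "E \<in> sets M" for E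
    using that by (simp add: emeasure_density flip: dens)
  have int_g: "(\<integral>\<^sup>+x. g x \<partial>M) < \<infinity>"
    using eq[OF sets.top] fin by (simp cong: nn_integral_cong)
  then have "AE x in M. g x \<noteq> \<infinity>"
    by (intro nn_integral_noteq_infinite) auto
  then have AE: "AE x in M. ennreal (enn2real (g x)) = g x"
    by eventually_elim (auto simp: less_top)
  show ?thesis
  proof (rule that[of "\<lambda>x. enn2real (g x)"])
    show "emeasure (sigma_part M \<nu>) E = (\<integral>\<^sup>+x\<in>E. ennreal (enn2real (g x)) \<partial>M)" if "E \<in> sets M" for E
      unfolding eq[OF that] using AE by (intro nn_integral_cong_AE) auto
    have "(\<integral>\<^sup>+x. ennreal (enn2real (g x)) \<partial>M) = (\<integral>\<^sup>+x. g x \<partial>M)"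
      using AE by (intro nn_integral_cong_AE)
    then show "integrable M (\<lambda>x. enn2real (g x))"
      using int_g by (intro integrableI_bounded) auto
  qed auto
qed

section \<open>Weighted positive multilinear forms\<close>

lemma power_superadditive:
  fixes a b :: "'a::linordered_semidom"
  assumes "0 < n" "0 \<le> a" "0 \<le> b"
  shows "a ^ n + b ^ n \<le> (a + b) ^ n"
  using assms(1)
proof (induction n rule: nat_induct_non_zero)
  case (Suc n)
  have "a ^ Suc n + b ^ Suc n \<le> (a + b) * (a ^ n + b ^ n)"
    using assms by (auto simp: algebra_simps intro!: add_increasing add_nonneg_nonneg mult_nonneg_nonneg)
  also have "\<dots> \<le> (a + b) * (a + b) ^ n"
    using assms Suc by (intro mult_left_mono) auto
  finally show ?case by simp
qed simp

lemma root_add_le: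
  fixes a b :: real
  assumes "0 < n" "0 \<le> a" "0 \<le> b"
  shows "root n (a + b) \<le> root n a + root n b"
proof -
  have "a + b = root n a ^ n + root n b ^ n"
    using assms by simp
  also have "\<dots> \<le> (root n a + root n b) ^ n"
    using assms by (intro power_superadditive) auto
  finally show ?thesis
    using assms by (metis add_nonneg_nonneg real_root_ge_zero real_root_le_mono real_root_pos2)
qed

section \<open>Operators that are linear and positive almost everywhere\<close>

lemma ae_linearD:
  assumes "ae_linear \<mu> S"
  shows ae_linear_measurable: "S f \<in> borel_measurable \<mu>"
    and ae_linear_add: "AE x in \<mu>. S (f + g) x = S f x + S g x"
    and ae_linear_scale: "AE x in \<mu>. S (c *\<^sub>R f) x = c * S f x"
  using assms by (auto simp: ae_linear_def)

lemma ae_multilinear_measurable: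
  assumes "ae_multilinear \<mu> T" shows "T h \<in> borel_measurable \<mu>"
proof -
  \<comment> \<open>\<open>undefined\<close> stands for an arbitrary slot; refilling it with its own
    entry gives back \<open>h\<close>.\<close>
  have "ae_linear \<mu> (\<lambda>f. T (h(undefined := f)))"
    using assms by (simp add: ae_multilinear_def)
  from ae_linear_measurable[OF this, of "h undefined"] show ?thesis by simp
qed

lemma ae_linear_sum:
  assumes S: "ae_linear \<mu> S"
  shows "AE x in \<mu>. S (\<Sum>k\<in>N. f k) x = (\<Sum>k\<in>N. S (f k) x)"
proof (induction N rule: infinite_finite_induct)
  case (insert k N)
  then show ?case
    using ae_linear_add[OF S, of "f k" "\<Sum>k\<in>N. f k"] by (auto elim: eventually_elim2)
qed (use ae_linear_scale[OF S, of 0 0] in auto)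

lemma ae_linear_mono:
  fixes f g :: "'y::{ordered_ab_group_add, real_vector}"
  assumes S: "ae_linear \<mu> S" "ae_positive \<mu> S" and "f \<le> g"
  shows "AE x in \<mu>. S f x \<le> S g x"
proof -
  have "AE x in \<mu>. 0 \<le> S (g - f) x"
    using S(2) \<open>f \<le> g\<close> by (auto simp: ae_positive_def)
  then show ?thesis
    using ae_linear_add[OF S(1), of f "g - f"] by eventually_elim auto
qed

section \<open>Truncation and norms in lattices\<close>

lemma pprt_minus_add_le:
  fixes a b e :: "'y::lattice_ab_group_add"
  assumes "0 \<le> a" "0 \<le> b" "0 \<le> e"
  shows "pprt (a - e) + pprt (b - e) \<le> pprt (a + b - e)"
proof -
  \<comment> \<open>Expanded, the left side is the supremum of \<open>0\<close>,
    \<open>a - e\<close>, \<open>b - e\<close> and \<open>(a - e) + (b - e)\<close>; each of these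
    lies below \<open>pprt (a + b - e)\<close>.\<close>
  have "a - e \<le> a + b - e" "b - e \<le> a + b - e" "(a - e) + (b - e) \<le> a + b - e"
    using assms by (auto simp: algebra_simps add_increasing add_increasing2)
  then show ?thesis
    by (auto simp: pprt_def add_sup_distrib_left add_sup_distrib_right intro: le_supI1)
qed

text \<open>Truncating every summand by \<open>e\<close> removes at least as much as truncating the
  sum by \<open>e\<close> once, so one \<open>e\<close> serves for any number of summands.\<close>

lemma sum_pprt_minus_le:
  fixes a :: "'k \<Rightarrow> 'y::lattice_ab_group_add"
  assumes "\<And>k. k \<in> N \<Longrightarrow> 0 \<le> a k" "0 \<le> e"
  shows "(\<Sum>k\<in>N. pprt (a k - e)) \<le> pprt ((\<Sum>k\<in>N. a k) - e)"
  using assms(1)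
proof (induction N rule: infinite_finite_induct)
  case (insert k N)
  then have "(\<Sum>k\<in>insert k N. pprt (a k - e)) \<le> pprt (a k - e) + pprt ((\<Sum>k\<in>N. a k) - e)"
    by simp
  also have "\<dots> \<le> pprt (a k + (\<Sum>k\<in>N. a k) - e)"
    using insert assms(2) by (intro pprt_minus_add_le sum_nonneg) auto
  finally show ?case using insert by simp
qed (use assms(2) in auto)

lemma member_le_sum_nonneg:
  fixes f :: "'k \<Rightarrow> 'y::ordered_ab_group_add"
  assumes "finite N" "i \<in> N" "\<And>j. j \<in> N \<Longrightarrow> 0 \<le> f j"
  shows "f i \<le> (\<Sum>j\<in>N. f j)"
  using assms by (auto simp: sum.remove[of N i] intro!: sum_nonneg)

lemma norm_mono_nonneg:
  fixes f g :: "'y::normed_lattice"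
  assumes "0 \<le> f" "f \<le> g"
  shows "norm f \<le> norm g"
  using assms order.trans[OF assms] by (intro norm_lattice_mono) (simp add: abs_of_nonneg)

lemma norm_pprt_le: "norm (pprt f) \<le> norm f" for f :: "'y::normed_lattice"
  by (intro norm_lattice_mono) (simp add: abs_prts)

text \<open>The exponents enter only through Hoelder's inequality, which supplies the two
  assumptions on the diagonal; what follows is free of \<open>q\<close>.\<close>

locale weighted_form =
  fixes \<mu> :: "'x measure"
    and T :: "('d::finite \<Rightarrow> 'y::normed_lattice) \<Rightarrow> 'x \<Rightarrow> real"
    and M :: "'x \<Rightarrow> real" and A :: real
  assumes multilinear: "ae_multilinear \<mu> T"
    and positive: "ae_multi_positive \<mu> T"
    and M_measurable [measurable]: "M \<in> borel_measurable \<mu>"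
    and M_nonneg: "AE x in \<mu>. 0 \<le> M x"
    and A_nonneg: "0 \<le> A"
    and integrable_diag: "0 \<le> f \<Longrightarrow> integrable \<mu> (\<lambda>x. M x * root CARD('d) (T (\<lambda>_. f) x))"
    and integral_diag: "0 \<le> f \<Longrightarrow> (LINT x|\<mu>. M x * root CARD('d) (T (\<lambda>_. f) x)) \<le> A * norm f"
begin

definition W :: "('d \<Rightarrow> 'y) \<Rightarrow> 'x \<Rightarrow> real" where
  "W h x = M x * root CARD('d) (T h x)"

lemma T_slot: "ae_linear \<mu> (\<lambda>f. T (h(i := f)))"
  using multilinear by (auto simp: ae_multilinear_def)

lemma T_measurable [measurable]: "T h \<in> borel_measurable \<mu>"
  using multilinear by (rule ae_multilinear_measurable)

lemma T_nonneg: "(\<And>i. 0 \<le> h i) \<Longrightarrow> AE x in \<mu>. 0 \<le> T h x"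
  using positive by (auto simp: ae_multi_positive_def)

lemma T_slot_mono:
  assumes "\<And>j. 0 \<le> h j" "f \<le> g"
  shows "AE x in \<mu>. T (h(i := f)) x \<le> T (h(i := g)) x"
proof (rule ae_linear_mono[OF T_slot _ assms(2)])
  show "ae_positive \<mu> (\<lambda>f. T (h(i := f)))"
    using assms by (auto simp: ae_positive_def intro!: T_nonneg)
qed

text \<open>Entries are replaced one slot at a time, so only finitely many exceptional null sets
  arise.\<close>

lemma T_mono:
  assumes "\<And>i. 0 \<le> h i" "\<And>i. h i \<le> k i"
  shows "AE x in \<mu>. T h x \<le> T k x"
proof -
  have "AE x in \<mu>. T h x \<le> T (override_on h k J) x" if "finite J" for J
    using that
  proof (induction J)
    case (insert j J)
    have "0 \<le> override_on h k J i" for i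
      using assms order.trans[OF assms] by (auto simp: override_on_def)
    moreover have "override_on h k J j \<le> k j"
      using assms by (auto simp: override_on_def)
    ultimately have "AE x in \<mu>. T (override_on h k J) x \<le> T ((override_on h k J)(j := k j)) x"
      using T_slot_mono[of "override_on h k J" "override_on h k J j" "k j" j] by simp
    with insert(3) show ?case
      unfolding override_on_insert by (rule eventually_elim2) (rule order.trans)
  qed simp
  from this[of UNIV] show ?thesis by (simp add: override_on_def)
qed

lemma T_scale: "AE x in \<mu>. T (\<lambda>i. c i *\<^sub>R h i) x = (\<Prod>i\<in>UNIV. c i) * T h x"
proof -
  have "AE x in \<mu>. T (override_on h (\<lambda>i. c i *\<^sub>R h i) J) x = (\<Prod>i\<in>J. c i) * T h x" if "finite J" for J
    using that
  proof (induction J)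
    case (insert j J)
    let ?k = "override_on h (\<lambda>i. c i *\<^sub>R h i) J"
    have "AE x in \<mu>. T (?k(j := c j *\<^sub>R h j)) x = c j * T (?k(j := h j)) x"
      by (rule ae_linear_scale[OF T_slot])
    moreover have "?k(j := h j) = ?k" using insert by (simp add: fun_upd_idem)
    ultimately have "AE x in \<mu>. T (?k(j := c j *\<^sub>R h j)) x = c j * T ?k x" by simp
    from this insert(3) show ?case
      unfolding override_on_insert
    proof eventually_elim
      case (elim x)
      then show ?case by (simp only: prod.insert[OF insert(1,2)] mult.assoc)
    qed
  qed simp
  from this[of UNIV] show ?thesis by (simp add: override_on_def)
qed

lemma W_measurable [measurable]: "W h \<in> borel_measurable \<mu>"
  unfolding W_def by measurable

lemma W_nonneg: "(\<And>i. 0 \<le> h i) \<Longrightarrow> AE x in \<mu>. 0 \<le> W h x"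
  using M_nonneg T_nonneg[of h] by (auto simp: W_def elim: eventually_elim2)

lemma W_mono:
  assumes "\<And>i. 0 \<le> h i" "\<And>i. h i \<le> k i"
  shows "AE x in \<mu>. W h x \<le> W k x"
  using M_nonneg T_mono[of h k, OF assms] by eventually_elim (simp add: W_def mult_left_mono)

lemma W_scale:
  assumes "\<And>i. 0 \<le> c i"
  shows "AE x in \<mu>. W (\<lambda>i. c i *\<^sub>R h i) x = root CARD('d) (\<Prod>i\<in>UNIV. c i) * W h x"
  using T_scale[of c h] by eventually_elim (simp add: W_def real_root_mult)

text \<open>Integrability is assumed on the diagonal; monotonicity compares \<open>W h\<close> with
  the diagonal at the sum of the entries.\<close>

lemma integrable_W:
  assumes "\<And>i. 0 \<le> h i"
  shows "integrable \<mu> (W h)"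
proof (rule Bochner_Integration.integrable_bound)
  show "integrable \<mu> (W (\<lambda>_. \<Sum>i\<in>UNIV. h i))"
    unfolding W_def using assms by (intro integrable_diag sum_nonneg) auto
  have "AE x in \<mu>. W h x \<le> W (\<lambda>_. \<Sum>i\<in>UNIV. h i) x"
    using assms by (intro W_mono) (auto intro: member_le_sum_nonneg)
  with W_nonneg[of h] show "AE x in \<mu>. norm (W h x) \<le> norm (W (\<lambda>_. \<Sum>i\<in>UNIV. h i) x)"
    using assms by (auto elim: eventually_elim2)
qed simp

text \<open>Multiplying one entry by \<open>t ^ d\<close> multiplies \<open>W\<close> by
  \<open>t\<close>. An entry of norm \<open>1 / t ^ d\<close> can thus be enlarged to norm one, and
  the bound for the enlarged tuple is divided by \<open>t\<close>.\<close>

lemma integral_W_small: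
  assumes "0 \<le> G" "0 < \<epsilon>"
  obtains \<delta> where "0 < \<delta>"
    "\<And>(h :: 'd \<Rightarrow> 'y) i. \<lbrakk>\<And>j. 0 \<le> h j; \<And>j. h j \<le> G; norm (h i) \<le> \<delta>\<rbrakk> \<Longrightarrow> (LINT x|\<mu>. W h x) \<le> \<epsilon>"
proof -
  let ?d = "CARD('d)"
  \<comment> \<open>Chosen so that \<open>A * (norm G + 1) \<le> t * \<epsilon>\<close>; the added
    \<open>1\<close> keeps \<open>t\<close> positive when \<open>A = 0\<close>.\<close>
  define t where "t = A * (norm G + 1) / \<epsilon> + 1"
  have t: "0 < t"
    unfolding t_def using A_nonneg assms(2) by (intro add_nonneg_pos divide_nonneg_pos mult_nonneg_nonneg) auto
  have t_eps: "A * (norm G + 1) \<le> t * \<epsilon>"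
    using assms(2) by (simp add: t_def distrib_right)
  show ?thesis
  proof (rule that[of "1 / t ^ ?d"])
    fix h :: "'d \<Rightarrow> 'y" and i assume h: "\<And>j. 0 \<le> h j" "\<And>j. h j \<le> G" and small: "norm (h i) \<le> 1 / t ^ ?d"
    \<comment> \<open>\<open>k\<close> dominates all entries after the enlargement, and its norm is
      at most \<open>norm G + 1\<close>.\<close>
    define k where "k = G + t ^ ?d *\<^sub>R h i"
    have nonneg: "0 \<le> t ^ ?d *\<^sub>R h i" using t h by (intro scaleR_nonneg_nonneg) auto
    then have k: "0 \<le> k" "t ^ ?d *\<^sub>R h i \<le> k" "G \<le> k"
      using assms(1) by (auto simp: k_def)
    have "W (h(i := t ^ ?d *\<^sub>R h i)) = W (\<lambda>j. (if j = i then t ^ ?d else 1) *\<^sub>R h j)"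
      by (intro arg_cong[where f = W]) auto
    then have "AE x in \<mu>. W (h(i := t ^ ?d *\<^sub>R h i)) x =
        root ?d (\<Prod>j\<in>UNIV. if j = i then t ^ ?d else 1) * W h x"
      using W_scale[of "\<lambda>j. if j = i then t ^ ?d else 1" h] t by simp
    moreover have "root ?d (\<Prod>j\<in>(UNIV::'d set). if j = i then t ^ ?d else 1) = t"
      using t by (simp add: real_root_power_cancel)
    moreover have "AE x in \<mu>. W (h(i := t ^ ?d *\<^sub>R h i)) x \<le> W (\<lambda>_. k) x"
      using h k nonneg by (intro W_mono) (auto intro: order.trans)
    ultimately have "AE x in \<mu>. t * W h x \<le> W (\<lambda>_. k) x"
      by (auto elim: eventually_elim2)
    then have "(LINT x|\<mu>. t * W h x) \<le> (LINT x|\<mu>. W (\<lambda>_. k) x)"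
      using h k by (intro integral_mono_AE integrable_mult_right integrable_W) auto
    also have "\<dots> \<le> A * norm k"
      unfolding W_def by (rule integral_diag) (rule k)
    also have "norm k \<le> norm G + t ^ ?d * norm (h i)"
      using t by (auto simp: k_def intro: order.trans[OF norm_triangle_ineq])
    also have "t ^ ?d * norm (h i) \<le> 1"
      using small t by (simp add: field_simps)
    also have "A * (norm G + 1) \<le> t * \<epsilon>" by (rule t_eps)
    finally have "t * (LINT x|\<mu>. W h x) \<le> t * \<epsilon>"
      using A_nonneg by (simp add: mult_left_mono)
    then show "(LINT x|\<mu>. W h x) \<le> \<epsilon>" using t by simp
  qed (use t in auto)
qed

lemma W_slot_add:
  assumes "\<And>j. 0 \<le> h j" "0 \<le> f" "0 \<le> g"
  shows "AE x in \<mu>. W (h(i := f + g)) x \<le> W (h(i := f)) x + W (h(i := g)) x"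
proof -
  have "AE x in \<mu>. 0 \<le> T (h(i := f)) x" "AE x in \<mu>. 0 \<le> T (h(i := g)) x"
    using assms by (auto intro!: T_nonneg)
  then show ?thesis
    using M_nonneg ae_linear_add[OF T_slot, of h i f g]
  proof eventually_elim
    case (elim x)
    then show ?case
      using mult_left_mono[OF root_add_le[of "CARD('d)" "T (h(i := f)) x" "T (h(i := g)) x"], of "M x"]
      by (simp add: W_def distrib_left)
  qed
qed

lemma set_integrable_W: "(\<And>i. 0 \<le> h i) \<Longrightarrow> E \<in> sets \<mu> \<Longrightarrow> set_integrable \<mu> E (W h)"
  unfolding set_integrable_def by (intro integrable_mult_indicator integrable_W)

text \<open>\<delta> depends on \<open>G\<close> and \<epsilon> alone; this uniformity over sets and
  tuples lets all terms of a finite sum be truncated at once.\<close>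

lemma set_integral_W_continuous:
  assumes "0 \<le> G" "0 < \<epsilon>"
  obtains \<delta> where "0 < \<delta>"
    "\<And>(h :: 'd \<Rightarrow> 'y) k E. \<lbrakk>E \<in> sets \<mu>; \<And>j. 0 \<le> k j; \<And>j. k j \<le> h j; \<And>j. h j \<le> G; \<And>j. norm (h j - k j) \<le> \<delta>\<rbrakk>
       \<Longrightarrow> (LINT x:E|\<mu>. W h x) \<le> (LINT x:E|\<mu>. W k x) + \<epsilon>"
proof -
  let ?d = "CARD('d)"
  have "0 < \<epsilon> / ?d" using assms by simp
  then obtain \<delta> where \<delta>: "0 < \<delta>"
    "\<And>(h :: 'd \<Rightarrow> 'y) i. \<lbrakk>\<And>j. 0 \<le> h j; \<And>j. h j \<le> G; norm (h i) \<le> \<delta>\<rbrakk> \<Longrightarrow> (LINT x|\<mu>. W h x) \<le> \<epsilon> / ?d"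
    using integral_W_small[OF assms(1)] by metis
  show ?thesis
  proof (rule that[OF \<delta>(1)])
    fix h k :: "'d \<Rightarrow> 'y" and E
    assume E: "E \<in> sets \<mu>" and k: "\<And>j. 0 \<le> k j" "\<And>j. k j \<le> h j" and h: "\<And>j. h j \<le> G"
      and close: "\<And>j. norm (h j - k j) \<le> \<delta>"
    have h0: "0 \<le> h j" for j using k order.trans by blast
    have kG: "k j \<le> G" for j using k h order.trans by blast
    \<comment> \<open>Entries of \<open>h\<close> are exchanged for those of \<open>k\<close> one by
      one. Subadditivity in the slot bounds the cost of an exchange by the integral of
      \<open>W\<close> with the difference in that slot, at most
      \<open>\<epsilon> / d\<close>.\<close>
    have "(LINT x:E|\<mu>. W h x) \<le> (LINT x:E|\<mu>. W (override_on h k J) x) + card J * (\<epsilon> / ?d)" if "finite J" for J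
      using that
    proof (induction J)
      case (insert j J)
      let ?m = "override_on h k J"
      have m0: "0 \<le> ?m i" and mG: "?m i \<le> G" for i using h h0 k kG by (auto simp: override_on_def)
      have mj: "?m = ?m(j := k j + (h j - k j))" using insert by (auto simp: override_on_def)
      have r: "0 \<le> h j - k j" "h j - k j \<le> G"
        using k h[of j] by (auto simp: algebra_simps intro: add_increasing2)
      have 0: "0 \<le> (?m(j := k j)) i" "0 \<le> (?m(j := h j - k j)) i" for i
        using m0 k r by auto
      have nonneg: "AE x in \<mu>. 0 \<le> W (?m(j := h j - k j)) x"
        by (rule W_nonneg) (rule 0)
      have "AE x in \<mu>. W ?m x \<le> W (?m(j := k j)) x + W (?m(j := h j - k j)) x"
        by (subst mj) (use m0 k r in \<open>intro W_slot_add\<close>)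
      then have "(LINT x:E|\<mu>. W ?m x) \<le> (LINT x:E|\<mu>. W (?m(j := k j)) x + W (?m(j := h j - k j)) x)"
        using m0 0 E by (intro set_integral_mono_AE set_integrable_W set_integral_add) auto
      also have "\<dots> = (LINT x:E|\<mu>. W (?m(j := k j)) x) + (LINT x:E|\<mu>. W (?m(j := h j - k j)) x)"
        using 0 E by (intro set_integral_add set_integrable_W)
      also have "(LINT x:E|\<mu>. W (?m(j := h j - k j)) x) \<le> (LINT x|\<mu>. W (?m(j := h j - k j)) x)"
        unfolding set_lebesgue_integral_def using 0 E nonneg
        by (intro integral_mono_AE integrable_mult_indicator integrable_W)
          (auto elim!: eventually_mono simp: indicator_def)
      also have "\<dots> \<le> \<epsilon> / ?d"
        using m0 mG r close by (intro \<delta>(2)[of _ j]) auto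
      finally show ?case
        using insert by (simp add: override_on_insert algebra_simps add_divide_distrib)
    qed simp
    from this[of UNIV] show "(LINT x:E|\<mu>. W h x) \<le> (LINT x:E|\<mu>. W k x) + \<epsilon>"
      by (simp add: override_on_def)
  qed
qed

end

locale factorizable_form = weighted_form \<mu> T M A
  for \<mu> :: "'x measure"
    and T :: "('d::finite \<Rightarrow> 'y::normed_lattice) \<Rightarrow> 'x \<Rightarrow> real"
    and M :: "'x \<Rightarrow> real" and A :: real +
  fixes B :: real and D :: "'y set"
  assumes B_nonneg: "0 \<le> B"
    and dense: "{f. 0 \<le> f} \<subseteq> closure {f \<in> D. 0 \<le> f}"
    and factorizable: "f \<in> D \<Longrightarrow> 0 \<le> f \<Longrightarrow>
          \<exists>S. ae_linear \<mu> S \<and> ae_positive \<mu> S \<and>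
            (\<forall>hs. (\<forall>i. 0 \<le> hs i) \<longrightarrow> (AE x in \<mu>. T hs x \<le> (\<Prod>i\<in>UNIV. S (hs i) x))) \<and>
            (AE x in \<mu>. S f x ^ CARD('d) \<le> B ^ CARD('d) * T (\<lambda>_. f) x)"
begin

text \<open>\<open>S\<close> acts on elements of \<open>'y\<close>, whereas \<open>le\<close>
  compares functions of \<open>x\<close>; the two meet by sorting the points according to the sets
  \<open>E k\<close> that contain them.\<close>

lemma sum_W_le_dense:
  fixes h :: "'k \<Rightarrow> 'd \<Rightarrow> 'y"
  assumes N: "finite N" and E: "\<And>k. k \<in> N \<Longrightarrow> E k \<in> sets \<mu>" and h: "\<And>k i. 0 \<le> h k i"
    and le: "AE x in \<mu>. (\<Sum>k\<in>N. indicator (E k) x *\<^sub>R (\<Sum>i\<in>UNIV. h k i)) \<le> g"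
    and g: "g \<in> D" "0 \<le> g"
  shows "(\<Sum>k\<in>N. CARD('d) * (LINT x:E k|\<mu>. W (h k) x)) \<le> A * B * norm g"
proof -
  let ?d = "CARD('d)"
  obtain S where S: "ae_linear \<mu> S" "ae_positive \<mu> S"
    and dom: "\<And>hs. (\<forall>i. 0 \<le> hs i) \<Longrightarrow> AE x in \<mu>. T hs x \<le> (\<Prod>i\<in>UNIV. S (hs i) x)"
    and diag: "AE x in \<mu>. S g x ^ ?d \<le> B ^ ?d * T (\<lambda>_. g) x"
    using factorizable[OF g] by blast
  define s where "s k = (\<Sum>i\<in>UNIV. h k i)" for k
  have S_nonneg: "AE x in \<mu>. 0 \<le> S f x" if "0 \<le> f" for f
    using S(2) that by (auto simp: ae_positive_def)
  \<comment> \<open>\<open>J\<close> will be the set of \<open>k\<close> in \<open>N\<close> with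
    \<open>x\<close> in \<open>E k\<close>. As \<open>N\<close> has finitely many subsets, one null
    set serves for all of them.\<close>
  have "AE x in \<mu>. \<forall>J\<in>Pow N. (\<Sum>k\<in>J. s k) \<le> g \<longrightarrow> (\<Sum>k\<in>J. S (s k) x) \<le> S g x"
  proof (intro AE_finite_allI)
    fix J assume "J \<in> Pow N"
    show "AE x in \<mu>. (\<Sum>k\<in>J. s k) \<le> g \<longrightarrow> (\<Sum>k\<in>J. S (s k) x) \<le> S g x"
    proof (cases "(\<Sum>k\<in>J. s k) \<le> g")
      case True
      from ae_linear_mono[OF S True] ae_linear_sum[OF S(1), of s J] show ?thesis
        by eventually_elim simp
    qed simp
  qed (use N in simp)
  moreover have "AE x in \<mu>. \<forall>k\<in>N. ?d * W (h k) x \<le> M x * S (s k) x"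
  proof (intro AE_finite_allI N)
    fix k
    have "AE x in \<mu>. \<forall>i\<in>UNIV. 0 \<le> S (h k i) x"
      by (intro AE_finite_allI S_nonneg h finite)
    moreover have "AE x in \<mu>. T (h k) x \<le> (\<Prod>i\<in>UNIV. S (h k i) x)"
      using h by (intro dom) auto
    ultimately show "AE x in \<mu>. ?d * W (h k) x \<le> M x * S (s k) x"
      using M_nonneg ae_linear_sum[OF S(1), of "h k" UNIV]
    proof eventually_elim
      case (elim x)
      let ?P = "\<Prod>i\<in>UNIV. S (h k i) x"
      have P: "0 \<le> ?P" using elim by (intro prod_nonneg) auto
      have "root ?d (T (h k) x) \<le> root ?d ?P" using elim by simp
      also have "\<dots> = ?P powr (1 / ?d)"
        using P by (simp add: root_powr_inverse)
      \<comment> \<open>AM--GM with equal weights \<open>1 / d\<close>; this is the origin of the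
        factor \<open>d\<close> in front of \<open>W\<close>.\<close>
      also have "\<dots> \<le> (\<Sum>i\<in>UNIV. S (h k i) x / ?d)"
        using elim by (intro arith_geom_mean) auto
      finally have "?d * root ?d (T (h k) x) \<le> S (s k) x"
        using elim by (simp add: s_def field_simps flip: sum_divide_distrib)
      then show ?case
        using mult_left_mono[OF _ elim(3)] by (fastforce simp: W_def ac_simps)
    qed
  qed
  moreover have "AE x in \<mu>. M x * S g x \<le> B * W (\<lambda>_. g) x"
    using diag M_nonneg S_nonneg[OF g(2)]
  proof eventually_elim
    case (elim x)
    have "S g x = root ?d (S g x ^ ?d)"
      using elim by (simp add: real_root_power_cancel)
    also have "\<dots> \<le> root ?d (B ^ ?d * T (\<lambda>_. g) x)" using elim by simp
    also have "\<dots> = B * root ?d (T (\<lambda>_. g) x)"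
      using B_nonneg by (simp add: real_root_mult real_root_power_cancel)
    finally show ?case
      using mult_left_mono[OF _ elim(2)] by (fastforce simp: W_def ac_simps)
  qed
  ultimately have "AE x in \<mu>. (\<Sum>k\<in>N. indicator (E k) x * (?d * W (h k) x)) \<le> B * W (\<lambda>_. g) x"
    using le M_nonneg
  proof eventually_elim
    case (elim x)
    let ?J = "N \<inter> {k. x \<in> E k}"
    have "(\<Sum>k\<in>N. indicator (E k) x * (?d * W (h k) x)) = (\<Sum>k\<in>?J. ?d * W (h k) x)"
      using N by (auto simp: indicator_def sum.inter_restrict intro!: sum.cong)
    also have "\<dots> \<le> (\<Sum>k\<in>?J. M x * S (s k) x)"
      using elim by (intro sum_mono) auto
    also have "\<dots> = M x * (\<Sum>k\<in>?J. S (s k) x)"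
      by (simp add: sum_distrib_left)
    also have "(\<Sum>k\<in>N. indicator (E k) x *\<^sub>R s k) = (\<Sum>k\<in>?J. s k)"
      using N by (auto simp: indicator_def sum.inter_restrict intro!: sum.cong)
    then have "(\<Sum>k\<in>?J. S (s k) x) \<le> S g x"
      using elim by (auto simp: s_def)
    then have "M x * (\<Sum>k\<in>?J. S (s k) x) \<le> M x * S g x"
      using elim by (intro mult_left_mono)
    also have "\<dots> \<le> B * W (\<lambda>_. g) x" by fact
    finally show ?case by simp
  qed
  moreover have int: "integrable \<mu> (\<lambda>x. indicator (E k) x * (?d * W (h k) x))" if "k \<in> N" for k
  proof -
    have "integrable \<mu> (\<lambda>x. indicator (E k) x *\<^sub>R W (h k) x)"
      using set_integrable_W[of "h k" "E k"] h E that by (simp add: set_integrable_def)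
    from integrable_mult_right[OF this, of ?d] show ?thesis by (simp add: ac_simps)
  qed
  ultimately have "(LINT x|\<mu>. (\<Sum>k\<in>N. indicator (E k) x * (?d * W (h k) x))) \<le> (LINT x|\<mu>. B * W (\<lambda>_. g) x)"
    using g by (intro integral_mono_AE Bochner_Integration.integrable_sum integrable_mult_right integrable_W) auto
  also have "\<dots> \<le> B * (A * norm g)"
    using integral_diag[OF g(2)] B_nonneg by (simp add: W_def mult_left_mono)
  also have "(LINT x|\<mu>. (\<Sum>k\<in>N. indicator (E k) x * (?d * W (h k) x))) =
      (\<Sum>k\<in>N. ?d * (LINT x:E k|\<mu>. W (h k) x))"
    using int by (simp add: Bochner_Integration.integral_sum set_lebesgue_integral_def mult.left_commute)
  finally show ?thesis by (simp add: ac_simps)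
qed

text \<open>For a general \<open>g\<close>, the \<open>h k i\<close> are cut down to \<open>pprt (h k i - pprt (g - g'))\<close> with \<open>g'\<close> from
  the dense set; by \<open>sum_pprt_minus_le\<close> these are dominated by \<open>g'\<close>.\<close>

lemma sum_W_le:
  fixes h :: "'k \<Rightarrow> 'd \<Rightarrow> 'y"
  assumes N: "finite N" and E: "\<And>k. k \<in> N \<Longrightarrow> E k \<in> sets \<mu>" and h: "\<And>k i. 0 \<le> h k i"
    and le: "AE x in \<mu>. (\<Sum>k\<in>N. indicator (E k) x *\<^sub>R (\<Sum>i\<in>UNIV. h k i)) \<le> g"
    and g: "0 \<le> g"
  shows "(\<Sum>k\<in>N. CARD('d) * (LINT x:E k|\<mu>. W (h k) x)) \<le> A * B * norm g"
proof -
  let ?d = "CARD('d)"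
  \<comment> \<open>\<open>c\<close> collects the errors of size \<epsilon>: \<open>A * B\<close>
    from replacing \<open>norm g'\<close> by \<open>norm g + \<epsilon>\<close>, and
    \<open>d\<close> for each index from truncating its entries.\<close>
  define c where "c = A * B + card N * ?d"
  \<comment> \<open>A common bound for all entries, so that one \<delta> handles every
    index.\<close>
  define G where "G = (\<Sum>k\<in>N. \<Sum>i\<in>UNIV. h k i)"
  have G: "h k i \<le> G" if "k \<in> N" for k i
  proof -
    have "h k i \<le> (\<Sum>i\<in>UNIV. h k i)" using h by (intro member_le_sum_nonneg) auto
    also have "\<dots> \<le> G" unfolding G_def using h N that by (intro member_le_sum_nonneg sum_nonneg) auto
    finally show ?thesis .
  qed
  have G0: "0 \<le> G" unfolding G_def by (intro sum_nonneg h)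
  have bound: "(\<Sum>k\<in>N. ?d * (LINT x:E k|\<mu>. W (h k) x)) \<le> A * B * norm g + c * \<epsilon>" if \<epsilon>: "0 < \<epsilon>" for \<epsilon>
  proof -
    obtain \<delta> where \<delta>: "0 < \<delta>"
      "\<And>(h :: 'd \<Rightarrow> 'y) k E. \<lbrakk>E \<in> sets \<mu>; \<And>j. 0 \<le> k j; \<And>j. k j \<le> h j; \<And>j. h j \<le> G; \<And>j. norm (h j - k j) \<le> \<delta>\<rbrakk>
       \<Longrightarrow> (LINT x:E|\<mu>. W h x) \<le> (LINT x:E|\<mu>. W k x) + \<epsilon>"
      using set_integral_W_continuous[OF G0 \<epsilon>] by metis
    obtain g' where g': "g' \<in> D" "0 \<le> g'" "dist g' g < min \<delta> \<epsilon>"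
    proof -
      have "g \<in> closure {f \<in> D. 0 \<le> f}" using dense g by auto
      then have "\<exists>y\<in>{f \<in> D. 0 \<le> f}. dist y g < min \<delta> \<epsilon>"
        using \<delta>(1) \<epsilon> by (simp only: closure_approachable)
      then show ?thesis using that by blast
    qed
    \<comment> \<open>An order bound for the excess of \<open>g\<close> over \<open>g'\<close>,
      small in norm because taking positive parts does not increase the norm.\<close>
    define e where "e = pprt (g - g')"
    define h' where "h' k i = pprt (h k i - e)" for k i
    have e: "0 \<le> e" "g - g' \<le> e"
      by (auto simp: e_def pprt_def)
    have norm_e: "norm e \<le> \<delta>"
      using norm_pprt_le[of "g - g'"] g'(3) by (simp add: e_def dist_norm norm_minus_commute)
    have h': "0 \<le> h' k i" "h' k i \<le> h k i" "h k i - h' k i \<le> e" for k i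
    proof -
      show "0 \<le> h' k i" by (simp add: h'_def)
      show "h' k i \<le> h k i" using e h[of k i] by (simp add: h'_def pprt_def)
      have "h k i - e \<le> h' k i" by (simp add: h'_def pprt_def)
      then show "h k i - h' k i \<le> e" by (simp add: algebra_simps)
    qed
    have close: "norm (h k i - h' k i) \<le> \<delta>" for k i
      using norm_mono_nonneg[of "h k i - h' k i" e] h'[of k i] norm_e by auto
    have "AE x in \<mu>. (\<Sum>k\<in>N. indicator (E k) x *\<^sub>R (\<Sum>i\<in>UNIV. h' k i)) \<le> g'"
      using le
    proof eventually_elim
      case (elim x)
      let ?a = "\<lambda>k i. indicator (E k) x *\<^sub>R h k i"
      have a: "0 \<le> ?a k i" for k i using h by (auto simp: indicator_def)
      \<comment> \<open>Truncation commutes with the indicator: off \<open>E k\<close> the right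
        side is the positive part of \<open>- e\<close>, which is \<open>0\<close>.\<close>
      have "indicator (E k) x *\<^sub>R h' k i = pprt (?a k i - e)" for k i
        using e by (auto simp: indicator_def h'_def)
      then have "(\<Sum>k\<in>N. indicator (E k) x *\<^sub>R (\<Sum>i\<in>UNIV. h' k i)) = (\<Sum>k\<in>N. \<Sum>i\<in>UNIV. pprt (?a k i - e))"
        by (simp add: scaleR_right.sum)
      also have "\<dots> \<le> (\<Sum>k\<in>N. pprt ((\<Sum>i\<in>UNIV. ?a k i) - e))"
        using a e by (intro sum_mono sum_pprt_minus_le)
      also have "\<dots> \<le> pprt ((\<Sum>k\<in>N. \<Sum>i\<in>UNIV. ?a k i) - e)"
        using a e by (intro sum_pprt_minus_le sum_nonneg)
      also have "\<dots> \<le> pprt g'"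
      proof (rule pprt_mono)
        have "(\<Sum>k\<in>N. \<Sum>i\<in>UNIV. ?a k i) \<le> g" using elim by (simp add: scaleR_right.sum)
        also have "g \<le> g' + e" using e by (simp add: algebra_simps)
        finally show "(\<Sum>k\<in>N. \<Sum>i\<in>UNIV. ?a k i) - e \<le> g'" by (simp add: algebra_simps)
      qed
      finally show ?case using g' by simp
    qed
    then have main: "(\<Sum>k\<in>N. ?d * (LINT x:E k|\<mu>. W (h' k) x)) \<le> A * B * norm g'"
      using g' h' by (intro sum_W_le_dense N E)
    have "(\<Sum>k\<in>N. ?d * (LINT x:E k|\<mu>. W (h k) x)) \<le> (\<Sum>k\<in>N. ?d * ((LINT x:E k|\<mu>. W (h' k) x) + \<epsilon>))"
      using h' close G by (intro sum_mono mult_left_mono \<delta>(2) E) auto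
    also have "\<dots> \<le> A * B * norm g' + card N * ?d * \<epsilon>"
      using main by (simp add: sum.distrib distrib_left)
    also have "A * B * norm g' \<le> A * B * (norm g + \<epsilon>)"
      using g'(3) norm_triangle_ineq2[of g' g] A_nonneg B_nonneg
      by (intro mult_left_mono) (auto simp: dist_norm)
    finally show ?thesis by (simp add: c_def algebra_simps)
  qed
  have c: "0 \<le> c" using A_nonneg B_nonneg by (simp add: c_def)
  show ?thesis
  proof (rule field_le_epsilon)
    fix e :: real assume "0 < e"
    \<comment> \<open>The denominator \<open>c + 1\<close> also covers \<open>c = 0\<close>.\<close>
    then have "c * (e / (c + 1)) \<le> e" using c by (simp add: field_simps)
    then show "(\<Sum>k\<in>N. ?d * (LINT x:E k|\<mu>. W (h k) x)) \<le> A * B * norm g + e"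
      using bound[of "e / (c + 1)"] \<open>0 < e\<close> c by simp
  qed
qed

end

section \<open>The dominating functional\<close>

text \<open>The pointwise vector space structure lets the sandwich theorem run on functions from
  \<open>'x\<close> to \<open>'y\<close>.\<close>

instantiation "fun" :: (type, real_vector) real_vector
begin

definition scaleR_fun_def: "c *\<^sub>R f = (\<lambda>x. c *\<^sub>R f x)"

instance
  by standard (auto simp: scaleR_fun_def scaleR_add_left scaleR_add_right fun_eq_iff)

end

lemma wedge_order_bounded:
  "wedge {F :: 'x \<Rightarrow> 'y::ordered_real_vector. (\<forall>x. 0 \<le> F x) \<and> (\<exists>g. \<forall>x. F x \<le> g)}"
proof (standard, safe)
  fix F G :: "'x \<Rightarrow> 'y" and f g assume "\<forall>x. F x \<le> f" "\<forall>x. G x \<le> g"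
  then show "\<exists>g. \<forall>x. (F + G) x \<le> g"
    by (intro exI[of _ "f + g"]) (auto intro: add_mono)
next
  fix F :: "'x \<Rightarrow> 'y" and g and c :: real assume "\<forall>x. F x \<le> g" "0 \<le> c"
  then show "\<exists>g. \<forall>x. (c *\<^sub>R F) x \<le> g"
    by (intro exI[of _ "c *\<^sub>R g"]) (auto simp: scaleR_fun_def intro: scaleR_left_mono)
qed (auto simp: scaleR_fun_def intro: scaleR_nonneg_nonneg)

context factorizable_form
begin

text \<open>A constant bound makes the infimum in \<open>upper\<close> range over a nonempty set and
  bounds the supremum in \<open>lower\<close>, so both functionals have real values.\<close>

definition order_bounded :: "('x \<Rightarrow> 'y) set" where
  "order_bounded = {F. (\<forall>x. 0 \<le> F x) \<and> (\<exists>g. \<forall>x. F x \<le> g)}"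

text \<open>Domination is asked only a.e., so \<open>upper\<close> vanishes on functions supported
  in a null set; the set function obtained later then vanishes on null sets.\<close>

definition bounds :: "('x \<Rightarrow> 'y) \<Rightarrow> 'y set" where
  "bounds F = {g. 0 \<le> g \<and> (AE x in \<mu>. F x \<le> g)}"

definition upper :: "('x \<Rightarrow> 'y) \<Rightarrow> real" where
  "upper F = (INF g\<in>bounds F. A * B * norm g)"

text \<open>Lists permit repeated pairs and overlapping sets, so minorants of two functions are
  added by concatenation.\<close>

definition minorants :: "('x \<Rightarrow> 'y) \<Rightarrow> ('x set \<times> ('d \<Rightarrow> 'y)) list set" where
  "minorants F = {L. (\<forall>(E, h)\<in>set L. E \<in> sets \<mu> \<and> (\<forall>i. 0 \<le> h i)) \<and>
     (AE x in \<mu>. (\<Sum>(E, h)\<leftarrow>L. indicator E x *\<^sub>R (\<Sum>i\<in>UNIV. h i)) \<le> F x)}"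

definition weight :: "('x set \<times> ('d \<Rightarrow> 'y)) list \<Rightarrow> real" where
  "weight L = (\<Sum>(E, h)\<leftarrow>L. CARD('d) * (LINT x:E|\<mu>. W h x))"

definition lower :: "('x \<Rightarrow> 'y) \<Rightarrow> real" where
  "lower F = (SUP L\<in>minorants F. weight L)"

sublocale cone: wedge order_bounded
  unfolding order_bounded_def by (rule wedge_order_bounded)

lemma weight_le:
  assumes "L \<in> minorants F" "g \<in> bounds F"
  shows "weight L \<le> A * B * norm g"
proof -
  have nth: "fst (L ! k) \<in> sets \<mu>" "0 \<le> snd (L ! k) i" if "k < length L" for k i
    using assms(1) nth_mem[OF that] by (auto simp: minorants_def split_beta)
  \<comment> \<open>Beyond the list the entries are \<open>0\<close>, because
    \<open>sum_W_le\<close> asks for nonnegativity at every index.\<close>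
  let ?h = "\<lambda>k. if k < length L then snd (L ! k) else (\<lambda>_. 0)"
  have "(\<Sum>k\<in>{0..<length L}. CARD('d) * (LINT x:fst (L ! k)|\<mu>. W (?h k) x)) \<le> A * B * norm g"
  proof (rule sum_W_le)
    have "AE x in \<mu>. (\<Sum>(E, h)\<leftarrow>L. indicator E x *\<^sub>R (\<Sum>i\<in>UNIV. h i)) \<le> F x"
      using assms(1) by (auto simp: minorants_def)
    moreover have "AE x in \<mu>. F x \<le> g" using assms(2) by (simp add: bounds_def)
    ultimately show "AE x in \<mu>. (\<Sum>k\<in>{0..<length L}. indicator (fst (L ! k)) x *\<^sub>R (\<Sum>i\<in>UNIV. ?h k i)) \<le> g"
      by eventually_elim (auto simp: sum_list_sum_nth split_beta intro: order.trans)
  qed (use nth assms(2) in \<open>auto simp: bounds_def\<close>)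
  then show ?thesis
    by (simp add: weight_def sum_list_sum_nth split_beta)
qed

lemma bounds_nonempty:
  assumes "F \<in> order_bounded" shows "bounds F \<noteq> {}"
proof -
  obtain g where g: "\<forall>x. F x \<le> g" and "\<forall>x. 0 \<le> F x" using assms by (auto simp: order_bounded_def)
  then have "0 \<le> g" using order.trans by blast
  then show ?thesis using g by (auto simp: bounds_def)
qed

lemma upper_le: "g \<in> bounds F \<Longrightarrow> upper F \<le> A * B * norm g"
  unfolding upper_def using A_nonneg B_nonneg
  by (intro cINF_lower bdd_belowI[of _ 0]) auto

lemma le_upper: "F \<in> order_bounded \<Longrightarrow> (\<And>g. g \<in> bounds F \<Longrightarrow> m \<le> A * B * norm g) \<Longrightarrow> m \<le> upper F"
  unfolding upper_def by (intro cINF_greatest bounds_nonempty)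

lemma le_lower:
  assumes "F \<in> order_bounded" "L \<in> minorants F" shows "weight L \<le> lower F"
proof -
  obtain g where g: "g \<in> bounds F" using bounds_nonempty[OF assms(1)] by auto
  show ?thesis
    unfolding lower_def using weight_le[OF _ g] assms(2)
    by (intro cSUP_upper bdd_aboveI[of _ "A * B * norm g"]) auto
qed

lemma Nil_minorant: "F \<in> order_bounded \<Longrightarrow> [] \<in> minorants F"
  by (auto simp: minorants_def order_bounded_def)

lemma lower_le: "F \<in> order_bounded \<Longrightarrow> (\<And>L. L \<in> minorants F \<Longrightarrow> weight L \<le> m) \<Longrightarrow> lower F \<le> m"
  unfolding lower_def using Nil_minorant by (intro cSUP_least) auto

lemma lower_nonneg: "F \<in> order_bounded \<Longrightarrow> 0 \<le> lower F"
  using le_lower[OF _ Nil_minorant] by (simp add: weight_def)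

lemma lower_le_upper: "F \<in> order_bounded \<Longrightarrow> lower F \<le> upper F"
  by (intro lower_le le_upper weight_le)

lemma sublinear_upper: "cone.sublinear upper"
proof -
  have "upper (F + G) \<le> upper F + upper G" if F: "F \<in> order_bounded" and G: "G \<in> order_bounded" for F G
  proof -
    have add: "upper (F + G) \<le> A * B * norm f + A * B * norm g" if "f \<in> bounds F" "g \<in> bounds G" for f g
    proof -
      have "f + g \<in> bounds (F + G)"
        using that by (auto simp: bounds_def elim!: eventually_elim2 intro: add_mono)
      then have "upper (F + G) \<le> A * B * norm (f + g)" by (rule upper_le)
      also have "\<dots> \<le> A * B * (norm f + norm g)"
        using A_nonneg B_nonneg by (intro mult_left_mono norm_triangle_ineq) auto
      finally show ?thesis by (simp add: distrib_left)
    qed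
    have "upper (F + G) - A * B * norm f \<le> upper G" if "f \<in> bounds F" for f
      using add[OF that] by (intro le_upper G) (simp add: diff_le_eq add.commute)
    then have "upper (F + G) - upper G \<le> upper F"
      by (intro le_upper F) (simp add: diff_le_eq add.commute)
    then show ?thesis by simp
  qed
  moreover have scale_le: "upper (c *\<^sub>R F) \<le> c * upper F" if F: "F \<in> order_bounded" and c: "0 < c" for F c
  proof -
    have "upper (c *\<^sub>R F) / c \<le> A * B * norm f" if f: "f \<in> bounds F" for f
    proof -
      have "c *\<^sub>R f \<in> bounds (c *\<^sub>R F)"
        using f c by (auto simp: bounds_def scaleR_fun_def elim!: eventually_mono intro: scaleR_left_mono scaleR_nonneg_nonneg)
      then have "upper (c *\<^sub>R F) \<le> A * B * norm (c *\<^sub>R f)" by (rule upper_le)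
      then show ?thesis using c by (simp add: field_simps)
    qed
    then have "upper (c *\<^sub>R F) / c \<le> upper F" by (intro le_upper F)
    then show ?thesis using c by (simp add: field_simps)
  qed
  moreover have "upper (c *\<^sub>R F) = c * upper F" if "F \<in> order_bounded" "0 < c" for F c
    using scale_le[OF that] scale_le[of "c *\<^sub>R F" "1/c"] that by (simp add: field_simps cone.scale)
  ultimately show ?thesis by (auto simp: cone.sublinear_def)
qed

lemma weight_scale:
  assumes "L \<in> minorants F" "0 < c"
  shows "map (\<lambda>(E, h). (E, \<lambda>i. c *\<^sub>R h i)) L \<in> minorants (c *\<^sub>R F)" (is "?L \<in> _")
    and "weight (map (\<lambda>(E, h). (E, \<lambda>i. c *\<^sub>R h i)) L) = c * weight L"
proof -
  have sum_eq: "(\<Sum>(E, h)\<leftarrow>?L. indicator E x *\<^sub>R (\<Sum>i\<in>UNIV. h i)) =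
      c *\<^sub>R (\<Sum>(E, h)\<leftarrow>L. indicator E x *\<^sub>R (\<Sum>i\<in>UNIV. h i))" for x
    by (induction L) (auto simp: scaleR_right_distrib scaleR_right.sum)
  have "AE x in \<mu>. (\<Sum>(E, h)\<leftarrow>L. indicator E x *\<^sub>R (\<Sum>i\<in>UNIV. h i)) \<le> F x"
    using assms(1) by (auto simp: minorants_def)
  then have "AE x in \<mu>. (\<Sum>(E, h)\<leftarrow>?L. indicator E x *\<^sub>R (\<Sum>i\<in>UNIV. h i)) \<le> (c *\<^sub>R F) x"
    unfolding sum_eq by eventually_elim (use assms(2) in \<open>auto simp: scaleR_fun_def intro: scaleR_left_mono\<close>)
  then show "?L \<in> minorants (c *\<^sub>R F)"
    using assms by (fastforce simp: minorants_def intro: scaleR_nonneg_nonneg)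
  have "(LINT x:E|\<mu>. W (\<lambda>i. c *\<^sub>R h i) x) = c * (LINT x:E|\<mu>. W h x)" if "E \<in> sets \<mu>" for E h
  proof -
    \<comment> \<open>All \<open>d\<close> entries carry the factor \<open>c\<close>, so the root
      returns \<open>c\<close> itself.\<close>
    have "AE x in \<mu>. W (\<lambda>i. c *\<^sub>R h i) x = c * W h x"
      using W_scale[of "\<lambda>_. c" h] assms(2) by (simp add: real_root_power_cancel)
    then have "(LINT x:E|\<mu>. W (\<lambda>i. c *\<^sub>R h i) x) = (LINT x:E|\<mu>. c * W h x)"
      unfolding set_lebesgue_integral_def using that by (intro integral_cong_AE) auto
    then show ?thesis by simp
  qed
  moreover have "\<forall>(E, h)\<in>set L. E \<in> sets \<mu>" using assms by (auto simp: minorants_def)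
  ultimately show "weight ?L = c * weight L"
    unfolding weight_def by (induction L) (auto simp: distrib_left)
qed

lemma superlinear_lower: "cone.sublinear (\<lambda>F. - lower F)"
proof -
  have "lower F + lower G \<le> lower (F + G)" if F: "F \<in> order_bounded" and G: "G \<in> order_bounded" for F G
  proof -
    have "weight L + weight L' \<le> lower (F + G)" if "L \<in> minorants F" "L' \<in> minorants G" for L L'
    proof -
      have "L @ L' \<in> minorants (F + G)"
        using that by (auto simp: minorants_def elim!: eventually_elim2 intro: add_mono)
      from le_lower[OF cone.add[OF F G] this] show ?thesis by (simp add: weight_def)
    qed
    then have "lower F \<le> lower (F + G) - weight L'" if "L' \<in> minorants G" for L'
      using that by (intro lower_le F) (auto simp: algebra_simps)
    then have "lower G \<le> lower (F + G) - lower F"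
      by (intro lower_le G) (auto simp: algebra_simps)
    then show ?thesis by simp
  qed
  then have "- lower (F + G) \<le> - lower F + - lower G" if "F \<in> order_bounded" "G \<in> order_bounded" for F G
    using that by (metis add.inverse_distrib_swap add.commute neg_le_iff_le)
  moreover have scale_le: "c * lower F \<le> lower (c *\<^sub>R F)" if F: "F \<in> order_bounded" and c: "0 < c" for F c
  proof -
    have "lower F \<le> lower (c *\<^sub>R F) / c"
      using weight_scale[OF _ c] le_lower[OF cone.scale[OF F, of c]] c
      by (intro lower_le F) (fastforce simp: field_simps)
    then show ?thesis using c by (simp add: field_simps)
  qed
  moreover have "lower (c *\<^sub>R F) = c * lower F" if "F \<in> order_bounded" "0 < c" for F c
    using scale_le[OF that] scale_le[of "c *\<^sub>R F" "1/c"] that by (simp add: field_simps cone.scale)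
  ultimately show ?thesis by (auto simp: cone.sublinear_def)
qed

text \<open>\<open>\<nu> f E\<close> is the value of the sandwiched \<phi> at the function equal to
  \<open>f\<close> on \<open>E\<close> and \<open>0\<close> elsewhere. Additivity of \<phi> thus
  gives additivity in the set, needed for the countably additive part, and additivity in
  \<open>f\<close>, needed for a linear \<open>R\<close>.\<close>

lemma finitely_additive_majorant:
  obtains \<nu> :: "'y \<Rightarrow> 'x set \<Rightarrow> ennreal" where
    "\<And>f. 0 \<le> f \<Longrightarrow> positive (sets \<mu>) (\<nu> f)"
    "\<And>f. 0 \<le> f \<Longrightarrow> additive (sets \<mu>) (\<nu> f)"
    "\<And>f. 0 \<le> f \<Longrightarrow> \<nu> f (space \<mu>) \<le> ennreal (A * B * norm f)"
    "\<And>f E. 0 \<le> f \<Longrightarrow> E \<in> null_sets \<mu> \<Longrightarrow> \<nu> f E = 0"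
    "\<And>f g E. 0 \<le> f \<Longrightarrow> 0 \<le> g \<Longrightarrow> \<nu> (f + g) E = \<nu> f E + \<nu> g E"
    "\<And>f c E. 0 \<le> f \<Longrightarrow> 0 < c \<Longrightarrow> \<nu> (c *\<^sub>R f) E = ennreal c * \<nu> f E"
    "\<And>h E. (\<And>i. 0 \<le> h i) \<Longrightarrow> E \<in> sets \<mu> \<Longrightarrow>
       (\<integral>\<^sup>+x\<in>E. ennreal (CARD('d) * W h x) \<partial>\<mu>) \<le> \<nu> (\<Sum>i\<in>UNIV. h i) E"
proof -
  obtain \<phi> where add: "\<And>F G. F \<in> order_bounded \<Longrightarrow> G \<in> order_bounded \<Longrightarrow> \<phi> (F + G) = \<phi> F + \<phi> G"
    and scale: "\<And>F c. F \<in> order_bounded \<Longrightarrow> 0 < c \<Longrightarrow> \<phi> (c *\<^sub>R F) = c * \<phi> F"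
    and lower: "\<And>F. F \<in> order_bounded \<Longrightarrow> lower F \<le> \<phi> F" and upper: "\<And>F. F \<in> order_bounded \<Longrightarrow> \<phi> F \<le> upper F"
    using cone.sandwich[OF sublinear_upper superlinear_lower lower_le_upper] by blast
  define s :: "'x set \<Rightarrow> 'y \<Rightarrow> 'x \<Rightarrow> 'y" where "s E f = (\<lambda>x. indicator E x *\<^sub>R f)" for E f
  have s: "s E f \<in> order_bounded" if "0 \<le> f" for E f
    using that by (auto simp: order_bounded_def s_def indicator_def)
  have nonneg: "0 \<le> \<phi> F" if "F \<in> order_bounded" for F
    using lower[OF that] lower_nonneg[OF that] by simp
  have s_add: "s E (f + g) = s E f + s E g" and s_scale: "s E (c *\<^sub>R f) = c *\<^sub>R s E f" for E f g c
    by (auto simp: s_def fun_eq_iff scaleR_fun_def scaleR_right_distrib)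
  have null: "\<phi> (s E f) = 0" if "0 \<le> f" "AE x in \<mu>. x \<notin> E" for f E
  proof -
    have "AE x in \<mu>. s E f x \<le> 0" using that(2) by eventually_elim (simp add: s_def)
    then have "0 \<in> bounds (s E f)" by (simp add: bounds_def)
    from upper_le[OF this] show ?thesis using upper[OF s[OF that(1), of E]] nonneg[OF s[OF that(1), of E]] by simp
  qed
  show ?thesis
  proof (rule that[of "\<lambda>f E. ennreal (\<phi> (s E f))"])
    fix f :: 'y assume f: "0 \<le> f"
    show "positive (sets \<mu>) (\<lambda>E. ennreal (\<phi> (s E f)))"
      using null[OF f, of "{}"] by (simp add: positive_def)
    have "s (E \<union> E') f = s E f + s E' f" if "E \<inter> E' = {}" for E E'
      using that by (auto simp: s_def fun_eq_iff indicator_def)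
    then show "additive (sets \<mu>) (\<lambda>E. ennreal (\<phi> (s E f)))"
      by (auto simp: additive_def add s f nonneg)
    have "f \<in> bounds (s (space \<mu>) f)" using f by (auto simp: bounds_def s_def indicator_def)
    then show "ennreal (\<phi> (s (space \<mu>) f)) \<le> ennreal (A * B * norm f)"
      using upper[OF s[OF f]] upper_le by (intro ennreal_leI) (meson order.trans)
    show "ennreal (\<phi> (s E f)) = 0" if "E \<in> null_sets \<mu>" for E
      using null[OF f] AE_not_in[OF that] by simp
    show "ennreal (\<phi> (s E (f + g))) = ennreal (\<phi> (s E f)) + ennreal (\<phi> (s E g))" if "0 \<le> g" for g E
      using that f by (simp add: s_add add s nonneg)
    show "ennreal (\<phi> (s E (c *\<^sub>R f))) = ennreal c * ennreal (\<phi> (s E f))" if "0 < c" for c E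
      using that f by (simp add: s_scale scale s ennreal_mult' nonneg)
  next
    fix h :: "'d \<Rightarrow> 'y" and E assume h: "\<And>i. 0 \<le> h i" and E: "E \<in> sets \<mu>"
    let ?s = "s E (\<Sum>i\<in>UNIV. h i)"
    have bdd: "?s \<in> order_bounded" using h by (intro s sum_nonneg)
    have "(\<integral>\<^sup>+x\<in>E. ennreal (CARD('d) * W h x) \<partial>\<mu>) = (\<integral>\<^sup>+x. ennreal (CARD('d) * (indicator E x *\<^sub>R W h x)) \<partial>\<mu>)"
      by (intro nn_integral_cong) (auto simp: indicator_def)
    also have "\<dots> = ennreal (LINT x|\<mu>. CARD('d) * (indicator E x *\<^sub>R W h x))"
    proof (rule nn_integral_eq_integral)
      show "integrable \<mu> (\<lambda>x. CARD('d) * (indicator E x *\<^sub>R W h x))"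
        using set_integrable_W[of h E] h E by (intro integrable_mult_right) (simp add: set_integrable_def)
      have "AE x in \<mu>. 0 \<le> W h x" by (rule W_nonneg) (rule h)
      then show "AE x in \<mu>. 0 \<le> CARD('d) * (indicator E x *\<^sub>R W h x)"
        by eventually_elim (auto simp: indicator_def)
    qed
    also have "(LINT x|\<mu>. CARD('d) * (indicator E x *\<^sub>R W h x)) = weight [(E, h)]"
      by (simp add: weight_def set_lebesgue_integral_def)
    also have "\<dots> \<le> \<phi> ?s"
    proof -
      \<comment> \<open>The one-term list turns \<open>lower \<le> \<phi>\<close> into the lower
        bound for a single tuple.\<close>
      have "[(E, h)] \<in> minorants ?s" using h E by (auto simp: minorants_def s_def)
      then show ?thesis using le_lower[OF bdd] lower[OF bdd] by (meson order.trans)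
    qed
    finally show "(\<integral>\<^sup>+x\<in>E. ennreal (CARD('d) * W h x) \<partial>\<mu>) \<le> ennreal (\<phi> ?s)"
      by (simp add: ennreal_leI)
  qed
qed

end

section \<open>The factorizing operator\<close>

lemma AE_le_of_set_nn_integral_le:
  fixes u v :: "'a \<Rightarrow> ennreal"
  assumes [measurable]: "u \<in> borel_measurable M" "v \<in> borel_measurable M"
    and fin: "(\<integral>\<^sup>+x. v x \<partial>M) \<noteq> \<infinity>"
    and le: "\<And>E. E \<in> sets M \<Longrightarrow> (\<integral>\<^sup>+x\<in>E. u x \<partial>M) \<le> (\<integral>\<^sup>+x\<in>E. v x \<partial>M)"
  shows "AE x in M. u x \<le> v x"
proof -
  \<comment> \<open>The inequality is tested on the set where it fails; finiteness of the integral
    of \<open>v\<close> allows subtraction.\<close>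
  define E where "E = {x \<in> space M. v x < u x}"
  have E [measurable]: "E \<in> sets M" by (simp add: E_def)
  have "(\<integral>\<^sup>+x\<in>E. v x \<partial>M) \<le> (\<integral>\<^sup>+x. v x \<partial>M)"
    by (intro nn_integral_mono) (auto simp: indicator_def)
  then have fin_E: "(\<integral>\<^sup>+x\<in>E. v x \<partial>M) \<noteq> \<infinity>" using fin by (auto simp: top_unique)
  have "(\<integral>\<^sup>+x. u x * indicator E x - v x * indicator E x \<partial>M) =
      (\<integral>\<^sup>+x\<in>E. u x \<partial>M) - (\<integral>\<^sup>+x\<in>E. v x \<partial>M)"
    using fin_E by (intro nn_integral_diff) (auto simp: E_def indicator_def)
  also have "\<dots> = 0"
    using le[OF E] fin_E by (intro diff_eq_0_ennreal) (auto simp: less_top intro: le_less_trans)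
  finally have "AE x in M. u x * indicator E x - v x * indicator E x = 0"
    by (subst (asm) nn_integral_0_iff_AE) auto
  then show ?thesis
  proof (rule AE_mp, intro AE_I2 impI)
    fix x assume x: "x \<in> space M" and 0: "u x * indicator E x - v x * indicator E x = 0"
    show "u x \<le> v x"
    proof (rule ccontr)
      assume "\<not> u x \<le> v x"
      then have "v x < u x" "x \<in> E" using x by (auto simp: E_def)
      then have "0 < u x - v x" by (simp add: diff_gr0_ennreal)
      then show False using 0 \<open>x \<in> E\<close> by simp
    qed
  qed
qed

lemma AE_eq_of_set_nn_integral_eq:
  fixes u v :: "'a \<Rightarrow> ennreal"
  assumes "u \<in> borel_measurable M" "v \<in> borel_measurable M" "(\<integral>\<^sup>+x. v x \<partial>M) \<noteq> \<infinity>"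
    and eq: "\<And>E. E \<in> sets M \<Longrightarrow> (\<integral>\<^sup>+x\<in>E. u x \<partial>M) = (\<integral>\<^sup>+x\<in>E. v x \<partial>M)"
  shows "AE x in M. u x = v x"
proof -
  have "(\<integral>\<^sup>+x. u x \<partial>M) = (\<integral>\<^sup>+x. v x \<partial>M)"
    using eq[OF sets.top] by (simp cong: nn_integral_cong)
  then have "AE x in M. u x \<le> v x" "AE x in M. v x \<le> u x"
    using assms by (auto intro!: AE_le_of_set_nn_integral_le)
  then show ?thesis by eventually_elim auto
qed

text \<open>Weighted AM--GM inequalities for all positive rational weights amount to the bound by the
  product; take weights approximating \<open>1 / r i\<close>.\<close>

lemma power_le_prod_of_weights:
  fixes r :: "'d::finite \<Rightarrow> real"
  assumes r: "\<And>i. 0 \<le> r i" and t: "0 \<le> t"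
    and le: "\<And>w :: 'd \<Rightarrow> rat. (\<And>i. 0 < w i) \<Longrightarrow>
      CARD('d) * (root CARD('d) (\<Prod>i\<in>UNIV. of_rat (w i)) * t) \<le> (\<Sum>i\<in>UNIV. of_rat (w i) * r i)"
  shows "t ^ CARD('d) \<le> (\<Prod>i\<in>UNIV. r i)"
proof -
  let ?d = "CARD('d)"
  have bound: "t ^ ?d \<le> (\<Prod>i\<in>UNIV. r i + 2 * \<epsilon>)" if \<epsilon>: "0 < \<epsilon>" for \<epsilon>
  proof -
    \<comment> \<open>The upper bound on \<open>w\<close> makes each \<open>w i * r i\<close> at
      most \<open>1\<close>, so the right side of \<open>le\<close> is at most \<open>d\<close>; the
      lower bound turns \<open>1 / w i\<close> into at most \<open>r i + 2 * \<epsilon>\<close>. The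
      positive \<epsilon> is there because \<open>r i\<close> may be \<open>0\<close>.\<close>
    have "\<exists>w. 1 / (r i + 2 * \<epsilon>) < of_rat w \<and> of_rat w < 1 / (r i + \<epsilon>)" for i
      using r[of i] \<epsilon> by (intro of_rat_dense divide_strict_left_mono) (auto intro!: mult_pos_pos add_nonneg_pos)
    then obtain w where w: "\<And>i. 1 / (r i + 2 * \<epsilon>) < of_rat (w i)" "\<And>i. of_rat (w i) < 1 / (r i + \<epsilon>)"
      by metis
    have pos: "0 < r i + 2 * \<epsilon>" "0 < r i + \<epsilon>" for i using r[of i] \<epsilon> by auto
    have w_pos: "0 < (of_rat (w i) :: real)" for i
      using w(1)[of i] pos(1)[of i] by (meson divide_pos_pos less_trans zero_less_one)
    let ?P = "\<Prod>i\<in>UNIV. of_rat (w i) :: real"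
    have P: "0 < ?P" using w_pos by (intro prod_pos) auto
    have "?d * (root ?d ?P * t) \<le> (\<Sum>i\<in>UNIV. of_rat (w i) * r i)"
      using w_pos by (intro le) simp
    also have "\<dots> \<le> (\<Sum>i\<in>(UNIV::'d set). 1)"
    proof (rule sum_mono)
      fix i
      have "of_rat (w i) * r i \<le> 1 / (r i + \<epsilon>) * r i"
        using w(2)[of i] r[of i] by (intro mult_right_mono) auto
      also have "\<dots> \<le> 1" using pos(2)[of i] \<epsilon> by (simp add: field_simps)
      finally show "of_rat (w i) * r i \<le> 1" .
    qed
    finally have "root ?d ?P * t \<le> 1" by simp
    then have "(root ?d ?P * t) ^ ?d \<le> 1"
      using P t by (intro power_le_one) auto
    then have "?P * t ^ ?d \<le> 1"
      using P by (simp add: power_mult_distrib)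
    then have "t ^ ?d \<le> 1 / ?P" using P by (simp add: field_simps)
    also have "1 / ?P = (\<Prod>i\<in>UNIV. 1 / of_rat (w i))" by (simp add: prod_dividef)
    also have "\<dots> \<le> (\<Prod>i\<in>UNIV. r i + 2 * \<epsilon>)"
    proof (rule prod_mono)
      fix i
      show "0 \<le> 1 / (of_rat (w i) :: real) \<and> 1 / of_rat (w i) \<le> r i + 2 * \<epsilon>"
        using w(1)[of i] pos(1)[of i] w_pos[of i] by (auto simp: field_simps)
    qed
    finally show ?thesis .
  qed
  have "((\<lambda>\<epsilon>. \<Prod>i\<in>UNIV. r i + 2 * \<epsilon>) \<longlongrightarrow> (\<Prod>i\<in>UNIV. r i + 2 * 0)) (at_right 0)"
    by (intro tendsto_intros)
  moreover have "\<forall>\<^sub>F \<epsilon> in at_right 0. t ^ ?d \<le> (\<Prod>i\<in>UNIV. r i + 2 * \<epsilon>)"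
    using bound by (auto simp: eventually_at_right_less intro: eventually_mono[OF eventually_at_right_less])
  ultimately show ?thesis
    using tendsto_lowerbound by fastforce
qed

context factorizable_form
begin

text \<open>The countably additive part is additive and homogeneous as a function of \<nu>, and
  equal measures have a.e. equal densities; this makes \<open>r\<close> additive and homogeneous
  a.e.\<close>

lemma positive_majorant:
  assumes "sigma_finite_measure \<mu>"
  obtains r :: "'y \<Rightarrow> 'x \<Rightarrow> real" where
    "\<And>f. 0 \<le> f \<Longrightarrow> integrable \<mu> (r f)"
    "\<And>f x. 0 \<le> f \<Longrightarrow> 0 \<le> r f x"
    "\<And>f g. 0 \<le> f \<Longrightarrow> 0 \<le> g \<Longrightarrow> AE x in \<mu>. r (f + g) x = r f x + r g x"
    "\<And>f c. 0 \<le> f \<Longrightarrow> 0 < c \<Longrightarrow> AE x in \<mu>. r (c *\<^sub>R f) x = c * r f x"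
    "\<And>f. 0 \<le> f \<Longrightarrow> (\<integral>\<^sup>+x. r f x \<partial>\<mu>) \<le> ennreal (A * B * norm f)"
    "\<And>h. (\<And>i. 0 \<le> h i) \<Longrightarrow> AE x in \<mu>. CARD('d) * W h x \<le> r (\<Sum>i\<in>UNIV. h i) x"
proof -
  obtain \<nu> where pos: "\<And>f. 0 \<le> f \<Longrightarrow> positive (sets \<mu>) (\<nu> f)"
    and add: "\<And>f. 0 \<le> f \<Longrightarrow> additive (sets \<mu>) (\<nu> f)"
    and upper: "\<And>f. 0 \<le> f \<Longrightarrow> \<nu> f (space \<mu>) \<le> ennreal (A * B * norm f)"
    and null: "\<And>f E. 0 \<le> f \<Longrightarrow> E \<in> null_sets \<mu> \<Longrightarrow> \<nu> f E = 0"
    and plus: "\<And>f g E. 0 \<le> f \<Longrightarrow> 0 \<le> g \<Longrightarrow> \<nu> (f + g) E = \<nu> f E + \<nu> g E"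
    and scale: "\<And>f c E. 0 \<le> f \<Longrightarrow> 0 < c \<Longrightarrow> \<nu> (c *\<^sub>R f) E = ennreal c * \<nu> f E"
    and lower: "\<And>h E. (\<And>i. 0 \<le> h i) \<Longrightarrow> E \<in> sets \<mu> \<Longrightarrow>
       (\<integral>\<^sup>+x\<in>E. ennreal (CARD('d) * W h x) \<partial>\<mu>) \<le> \<nu> (\<Sum>i\<in>UNIV. h i) E"
    using finitely_additive_majorant by blast
  have "\<exists>r. integrable \<mu> r \<and> (\<forall>x. 0 \<le> r x) \<and>
      (\<forall>E\<in>sets \<mu>. emeasure (sigma_part \<mu> (\<nu> f)) E = (\<integral>\<^sup>+x\<in>E. ennreal (r x) \<partial>\<mu>))" if "0 \<le> f" for f
  proof -
    have "\<nu> f (space \<mu>) < \<infinity>" using upper[OF that] by (auto intro: le_less_trans)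
    from sigma_part_density[OF assms pos[OF that] add[OF that] this null[OF that]] show ?thesis
      by metis
  qed
  then obtain r where r_int: "\<And>f. 0 \<le> f \<Longrightarrow> integrable \<mu> (r f)"
    and r_nonneg: "\<And>f x. 0 \<le> f \<Longrightarrow> 0 \<le> r f x"
    and r: "\<And>f E. 0 \<le> f \<Longrightarrow> E \<in> sets \<mu> \<Longrightarrow>
      emeasure (sigma_part \<mu> (\<nu> f)) E = (\<integral>\<^sup>+x\<in>E. ennreal (r f x) \<partial>\<mu>)"
    by metis
  have r_meas [measurable]: "r f \<in> borel_measurable \<mu>" if "0 \<le> f" for f
    using r_int[OF that] by simp
  have r_le: "(\<integral>\<^sup>+x. r f x \<partial>\<mu>) \<le> ennreal (A * B * norm f)" if "0 \<le> f" for f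
  proof -
    have "(\<integral>\<^sup>+x. r f x \<partial>\<mu>) = emeasure (sigma_part \<mu> (\<nu> f)) (space \<mu>)"
      using r[OF that sets.top] by (simp cong: nn_integral_cong)
    also have "\<dots> \<le> \<nu> f (space \<mu>)"
      by (intro emeasure_sigma_part_le_self pos add that sets.top)
    finally show ?thesis using upper[OF that] by simp
  qed
  have fin: "(\<integral>\<^sup>+x. r f x \<partial>\<mu>) \<noteq> \<infinity>" if "0 \<le> f" for f
    using r_le[OF that] by (auto simp: top_unique)
  show ?thesis
  proof (rule that[of r])
    fix f g :: 'y assume f: "0 \<le> f" and g: "0 \<le> g"
    then have fg: "0 \<le> f + g" by simp
    have "AE x in \<mu>. ennreal (r f x) + ennreal (r g x) = ennreal (r (f + g) x)"
    proof (rule AE_eq_of_set_nn_integral_eq)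
      fix E assume E: "E \<in> sets \<mu>"
      have "(\<integral>\<^sup>+x\<in>E. (ennreal (r f x) + ennreal (r g x)) \<partial>\<mu>) =
          (\<integral>\<^sup>+x\<in>E. ennreal (r f x) \<partial>\<mu>) + (\<integral>\<^sup>+x\<in>E. ennreal (r g x) \<partial>\<mu>)"
        using E f g by (simp add: distrib_right nn_integral_add)
      also have "\<dots> = emeasure (sigma_part \<mu> (\<lambda>A. \<nu> f A + \<nu> g A)) E"
        using E f g by (simp add: emeasure_sigma_part_add pos add r)
      also have "sigma_part \<mu> (\<lambda>A. \<nu> f A + \<nu> g A) = sigma_part \<mu> (\<nu> (f + g))"
        using f g by (intro sigma_part_cong) (simp add: plus)
      finally show "(\<integral>\<^sup>+x\<in>E. (ennreal (r f x) + ennreal (r g x)) \<partial>\<mu>) =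
          (\<integral>\<^sup>+x\<in>E. ennreal (r (f + g) x) \<partial>\<mu>)"
        using r[OF fg E] by simp
    qed (use f g fg fin in auto)
    then show "AE x in \<mu>. r (f + g) x = r f x + r g x"
      by eventually_elim (use r_nonneg f g fg in \<open>simp flip: ennreal_plus\<close>)
  next
    fix f :: 'y and c :: real assume f: "0 \<le> f" and c: "0 < c"
    then have cf: "0 \<le> c *\<^sub>R f" by (intro scaleR_nonneg_nonneg) auto
    have "AE x in \<mu>. ennreal c * ennreal (r f x) = ennreal (r (c *\<^sub>R f) x)"
    proof (rule AE_eq_of_set_nn_integral_eq)
      fix E assume E: "E \<in> sets \<mu>"
      have "(\<integral>\<^sup>+x\<in>E. (ennreal c * ennreal (r f x)) \<partial>\<mu>) = ennreal c * (\<integral>\<^sup>+x\<in>E. ennreal (r f x) \<partial>\<mu>)"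
        using E f by (simp add: mult.assoc nn_integral_cmult)
      also have "\<dots> = emeasure (sigma_part \<mu> (\<lambda>A. ennreal c * \<nu> f A)) E"
        using E f c by (simp add: emeasure_sigma_part_cmult pos add r)
      also have "sigma_part \<mu> (\<lambda>A. ennreal c * \<nu> f A) = sigma_part \<mu> (\<nu> (c *\<^sub>R f))"
        using f c by (intro sigma_part_cong) (simp add: scale)
      finally show "(\<integral>\<^sup>+x\<in>E. (ennreal c * ennreal (r f x)) \<partial>\<mu>) = (\<integral>\<^sup>+x\<in>E. ennreal (r (c *\<^sub>R f) x) \<partial>\<mu>)"
        using r[OF cf E] by simp
    qed (use f cf fin in auto)
    then show "AE x in \<mu>. r (c *\<^sub>R f) x = c * r f x"
      by eventually_elim (use r_nonneg f c cf in \<open>simp flip: ennreal_mult'\<close>)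
  next
    fix h :: "'d \<Rightarrow> 'y" assume h: "\<And>i. 0 \<le> h i"
    let ?s = "\<Sum>i\<in>UNIV. h i"
    have s: "0 \<le> ?s" by (intro sum_nonneg h)
    \<comment> \<open>This measure is countably additive and lies below \<open>\<nu> ?s\<close>. By
      maximality it lies below the countably additive part, so discarding the rest of \<nu> does not
      spoil the lower bound.\<close>
    let ?N = "density \<mu> (\<lambda>x. ennreal (CARD('d) * W h x))"
    have "AE x in \<mu>. ennreal (CARD('d) * W h x) \<le> ennreal (r ?s x)"
    proof (rule AE_le_of_set_nn_integral_le)
      fix E assume E: "E \<in> sets \<mu>"
      have "emeasure ?N E \<le> emeasure (sigma_part \<mu> (\<nu> ?s)) E"
        using lower[of h] h by (intro sigma_part_greatest pos add s E) (auto simp: emeasure_density)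
      then show "(\<integral>\<^sup>+x\<in>E. ennreal (CARD('d) * W h x) \<partial>\<mu>) \<le> (\<integral>\<^sup>+x\<in>E. ennreal (r ?s x) \<partial>\<mu>)"
        using E r[OF s E] by (simp add: emeasure_density)
    qed (use s fin in auto)
    then show "AE x in \<mu>. CARD('d) * W h x \<le> r ?s x"
      by eventually_elim (use r_nonneg[OF s] in simp)
  qed (use r_int r_nonneg r_le in auto)
qed

theorem factorization:
  assumes "sigma_finite_measure \<mu>"
  obtains R where "ae_linear \<mu> R" "ae_positive \<mu> R" "\<And>f. integrable \<mu> (R f)"
    "\<And>fs. (\<And>i. 0 \<le> fs i) \<Longrightarrow> AE x in \<mu>. M x ^ CARD('d) * T fs x \<le> (\<Prod>i\<in>UNIV. R (fs i) x)"
    "\<And>f. (\<integral>\<^sup>+x. ennreal \<bar>R f x\<bar> \<partial>\<mu>) \<le> ennreal (A * B * norm f)"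
proof -
  obtain r :: "'y \<Rightarrow> 'x \<Rightarrow> real" where r_int: "\<And>f. 0 \<le> f \<Longrightarrow> integrable \<mu> (r f)"
    and r_nonneg: "\<And>f x. 0 \<le> f \<Longrightarrow> 0 \<le> r f x"
    and r_add: "\<And>f g. 0 \<le> f \<Longrightarrow> 0 \<le> g \<Longrightarrow> AE x in \<mu>. r (f + g) x = r f x + r g x"
    and r_scale: "\<And>f c. 0 \<le> f \<Longrightarrow> 0 < c \<Longrightarrow> AE x in \<mu>. r (c *\<^sub>R f) x = c * r f x"
    and r_le: "\<And>f. 0 \<le> f \<Longrightarrow> (\<integral>\<^sup>+x. r f x \<partial>\<mu>) \<le> ennreal (A * B * norm f)"
    and r_W: "\<And>h. (\<And>i. 0 \<le> h i) \<Longrightarrow> AE x in \<mu>. CARD('d) * W h x \<le> r (\<Sum>i\<in>UNIV. h i) x"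
    using positive_majorant[OF assms] by blast
  \<comment> \<open>Linear extension from the positive cone by positive and negative parts.\<close>
  define R where "R f x = r (pprt f) x - r (pprt (- f)) x" for f x
  have parts: "f = pprt f - pprt (- f)" for f :: 'y
    using prts[of f] by (simp add: pprt_neg)
  \<comment> \<open>Every representation as a difference of nonnegative elements gives the same
    value a.e.; linearity of \<open>R\<close> rests on this.\<close>
  have R_diff: "AE x in \<mu>. R (f - g) x = r f x - r g x" if "0 \<le> f" "0 \<le> g" for f g
  proof -
    have "pprt (f - g) + g = f + pprt (- (f - g))"
      using parts[of "f - g"] by (simp add: algebra_simps)
    then have "AE x in \<mu>. r (pprt (f - g) + g) x = r (f + pprt (- (f - g))) x" by simp
    with r_add[OF zero_le_pprt[of "f - g"] that(2)] r_add[OF that(1) zero_le_pprt[of "- (f - g)"]]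
    show ?thesis by eventually_elim (simp add: R_def)
  qed
  have r_0: "AE x in \<mu>. r 0 x = 0"
    using r_add[of 0 0] by simp
  have R_r: "AE x in \<mu>. R f x = r f x" if "0 \<le> f" for f
    using R_diff[OF that, of 0] r_0 by (auto elim: eventually_elim2)
  have R_add: "AE x in \<mu>. R (f + g) x = R f x + R g x" for f g
  proof -
    have "f + g = (pprt f - pprt (- f)) + (pprt g - pprt (- g))"
      by (simp flip: parts)
    also have "\<dots> = (pprt f + pprt g) - (pprt (- f) + pprt (- g))"
      by (simp add: algebra_simps)
    finally have "AE x in \<mu>. R (f + g) x = r (pprt f + pprt g) x - r (pprt (- f) + pprt (- g)) x"
      using R_diff[of "pprt f + pprt g" "pprt (- f) + pprt (- g)"] by simp
    with r_add[of "pprt f" "pprt g"] r_add[of "pprt (- f)" "pprt (- g)"] show ?thesis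
      by (simp add: R_def) (auto elim!: eventually_elim2)
  qed
  have R_scale_pos: "AE x in \<mu>. R (c *\<^sub>R f) x = c * R f x" if c: "0 < c" for c f
  proof -
    have "c *\<^sub>R f = c *\<^sub>R pprt f - c *\<^sub>R pprt (- f)"
      using parts[of f] by (metis scaleR_right_diff_distrib)
    then have "AE x in \<mu>. R (c *\<^sub>R f) x = r (c *\<^sub>R pprt f) x - r (c *\<^sub>R pprt (- f)) x"
      using R_diff[of "c *\<^sub>R pprt f" "c *\<^sub>R pprt (- f)"] c by (simp add: scaleR_nonneg_nonneg)
    moreover have "AE x in \<mu>. r (c *\<^sub>R pprt f) x = c * r (pprt f) x"
      "AE x in \<mu>. r (c *\<^sub>R pprt (- f)) x = c * r (pprt (- f)) x"
      by (auto intro!: r_scale c)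
    ultimately show ?thesis by eventually_elim (simp add: R_def algebra_simps)
  qed
  have R_neg: "R (- f) x = - R f x" for f x by (simp add: R_def)
  have R_scale: "AE x in \<mu>. R (c *\<^sub>R f) x = c * R f x" for c f
  proof (cases c "0 :: real" rule: linorder_cases)
    case less
    then have "0 < - c" by simp
    from R_scale_pos[OF this, of f] show ?thesis by (simp add: R_neg)
  qed (use R_scale_pos R_r[of 0] r_0 in \<open>auto simp: R_def\<close>)
  have R_int: "integrable \<mu> (R f)" for f
    unfolding R_def by (intro Bochner_Integration.integrable_diff r_int zero_le_pprt)
  have lin: "ae_linear \<mu> R"
    using R_int R_add R_scale by (auto simp: ae_linear_def)
  show ?thesis
  proof (rule that[OF lin _ R_int])
    show "ae_positive \<mu> R"
      unfolding ae_positive_def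
    proof (intro allI impI)
      fix f :: 'y assume f: "0 \<le> f"
      show "AE x in \<mu>. 0 \<le> R f x"
        using R_r[OF f] by eventually_elim (simp add: r_nonneg f)
    qed
    fix f
    \<comment> \<open>\<open>\<bar>f\<bar>\<close> is the sum of the two parts of \<open>f\<close>,
      so \<open>\<bar>R f\<bar> \<le> r \<bar>f\<bar>\<close> a.e. and the bound on the cone extends
      with the same constant.\<close>
    have "(\<integral>\<^sup>+x. ennreal \<bar>R f x\<bar> \<partial>\<mu>) \<le> (\<integral>\<^sup>+x. ennreal (r \<bar>f\<bar> x) \<partial>\<mu>)"
    proof (rule nn_integral_mono_AE)
      have "AE x in \<mu>. r \<bar>f\<bar> x = r (pprt f) x + r (pprt (- f)) x"
        using r_add[of "pprt f" "pprt (- f)"] by (simp add: abs_prts pprt_neg)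
      then show "AE x in \<mu>. ennreal \<bar>R f x\<bar> \<le> ennreal (r \<bar>f\<bar> x)"
      proof eventually_elim
        case (elim x)
        then show ?case
          using r_nonneg[of "pprt f" x] r_nonneg[of "pprt (- f)" x] by (intro ennreal_leI) (simp add: R_def)
      qed
    qed
    also have "\<dots> \<le> ennreal (A * B * norm \<bar>f\<bar>)" by (rule r_le) simp
    also have "norm \<bar>f\<bar> = norm f" by (intro antisym norm_lattice_mono) auto
    finally show "(\<integral>\<^sup>+x. ennreal \<bar>R f x\<bar> \<partial>\<mu>) \<le> ennreal (A * B * norm f)" .
  next
    fix fs :: "'d \<Rightarrow> 'y" assume fs: "\<And>i. 0 \<le> fs i"
    \<comment> \<open>Rational weight vectors are countably many, so one null set works for all; the
      passage to the product is then made at each remaining point.\<close>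
    have "AE x in \<mu>. \<forall>w :: 'd \<Rightarrow> rat. (\<forall>i. 0 < w i) \<longrightarrow>
        CARD('d) * (root CARD('d) (\<Prod>i\<in>UNIV. of_rat (w i)) * W fs x) \<le> (\<Sum>i\<in>UNIV. of_rat (w i) * R (fs i) x)"
      unfolding AE_all_countable
    proof
      fix w :: "'d \<Rightarrow> rat"
      show "AE x in \<mu>. (\<forall>i. 0 < w i) \<longrightarrow>
        CARD('d) * (root CARD('d) (\<Prod>i\<in>UNIV. of_rat (w i)) * W fs x) \<le> (\<Sum>i\<in>UNIV. of_rat (w i) * R (fs i) x)"
      proof (cases "\<forall>i. 0 < w i")
        case True
        \<comment> \<open>The linear bound is applied to reweighted entries: \<open>W\<close> gains
          the geometric mean of the weights, the right side becomes the weighted sum.\<close>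
        let ?h = "\<lambda>i. of_rat (w i) *\<^sub>R fs i"
        have h: "0 \<le> ?h i" for i using True fs by (intro scaleR_nonneg_nonneg) (auto simp: less_imp_le)
        have "AE x in \<mu>. W ?h x = root CARD('d) (\<Prod>i\<in>UNIV. of_rat (w i)) * W fs x"
          using True by (intro W_scale) (simp add: less_imp_le)
        moreover have "AE x in \<mu>. CARD('d) * W ?h x \<le> r (\<Sum>i\<in>UNIV. ?h i) x"
          by (rule r_W) (rule h)
        moreover have "AE x in \<mu>. R (\<Sum>i\<in>UNIV. ?h i) x = r (\<Sum>i\<in>UNIV. ?h i) x"
          by (intro R_r sum_nonneg h)
        moreover have "AE x in \<mu>. R (\<Sum>i\<in>UNIV. ?h i) x = (\<Sum>i\<in>UNIV. R (?h i) x)"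
          by (rule ae_linear_sum[OF lin])
        moreover have "AE x in \<mu>. \<forall>i\<in>UNIV. R (?h i) x = of_rat (w i) * R (fs i) x"
          by (intro AE_finite_allI R_scale finite)
        ultimately show ?thesis by eventually_elim simp
      qed auto
    qed
    moreover have "AE x in \<mu>. \<forall>i\<in>UNIV. R (fs i) x = r (fs i) x"
      by (intro AE_finite_allI R_r fs finite)
    ultimately show "AE x in \<mu>. M x ^ CARD('d) * T fs x \<le> (\<Prod>i\<in>UNIV. R (fs i) x)"
      using M_nonneg T_nonneg[of fs, OF fs]
    proof eventually_elim
      case (elim x)
      have "W fs x ^ CARD('d) \<le> (\<Prod>i\<in>UNIV. R (fs i) x)"
        using elim fs r_nonneg by (intro power_le_prod_of_weights) (auto simp: W_def)
      then show ?case using elim by (simp add: W_def power_mult_distrib)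
    qed
  qed
qed

end

section \<open>Hoelder's inequality\<close>

text \<open>A finite bound excludes the default value \<open>\<infinity>\<close> of
  \<open>Lp_norm\<close>, after which real powers can be inverted.\<close>

lemma Lp_norm_leD:
  assumes "Lp_norm p \<mu> g \<le> ennreal a" "0 \<le> a" "p \<noteq> \<infinity>" "0 < enn2real p"
  shows "(\<integral>\<^sup>+x. ennreal (\<bar>g x\<bar> powr enn2real p) \<partial>\<mu>) \<le> ennreal (a powr enn2real p)"
proof -
  let ?I = "\<integral>\<^sup>+x. ennreal (\<bar>g x\<bar> powr enn2real p) \<partial>\<mu>"
  have fin: "?I \<noteq> \<infinity>"
    using assms(1,3) by (auto simp: Lp_norm_def Let_def top_unique split: if_splits)
  have "enn2real ?I powr (1 / enn2real p) \<le> a"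
    using assms(1-3) fin by (simp add: Lp_norm_def Let_def)
  then have "(enn2real ?I powr (1 / enn2real p)) powr enn2real p \<le> a powr enn2real p"
    using assms(4) by (intro powr_mono2) auto
  then have "enn2real ?I \<le> a powr enn2real p"
    using assms(4) by (simp add: powr_powr)
  moreover have "?I = ennreal (enn2real ?I)"
    using fin by (simp add: less_top)
  ultimately show ?thesis by (metis ennreal_leI)
qed

lemma Lp_norm_one: "Lp_norm 1 \<mu> g = (\<integral>\<^sup>+x. ennreal \<bar>g x\<bar> \<partial>\<mu>)"
  by (auto simp: Lp_norm_def Let_def less_top)

lemma conjugate_exponents_real:
  fixes q q' :: ennreal
  assumes "1 \<le> q" "q < \<infinity>" "q' \<noteq> \<infinity>" "1 / q + 1 / q' = 1"
  shows "1 < enn2real q" "1 < enn2real q'" "1 / enn2real q + 1 / enn2real q' = 1"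
proof -
  obtain p where p: "q = ennreal p" "1 \<le> p"
    using assms(1,2) by (cases q) (auto simp flip: ennreal_1)
  obtain s where s: "q' = ennreal s" "0 \<le> s"
    using assms(3) by (cases q') auto
  \<comment> \<open>In \<open>ennreal\<close>, \<open>1 / 0\<close> is infinite.\<close>
  have "q' \<noteq> 0" using assms(4) by auto
  then have "0 < s" using s by (cases "s = 0") auto
  then have "ennreal (1 / p + 1 / s) = ennreal 1"
    using assms(4) p s by (simp add: divide_ennreal flip: ennreal_1 ennreal_plus)
  then have eq: "1 / p + 1 / s = 1"
    using p \<open>0 < s\<close> by (subst (asm) ennreal_inj) auto
  have "0 < 1 / p" "0 < 1 / s" using p \<open>0 < s\<close> by auto
  with eq have "1 / p < 1" "1 / s < 1" by linarith+
  then show "1 < enn2real q" "1 < enn2real q'" using p s \<open>0 < s\<close> by (auto simp: field_simps)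
  show "1 / enn2real q + 1 / enn2real q' = 1" using eq p s by simp
qed

text \<open>Young's inequality for \<open>\<bar>f\<bar>\<close> and
  \<open>\<bar>g\<bar> / a\<close>, normalized by the bound \<open>a\<close> rather than by the norm
  of \<open>g\<close>. Two cases stand apart: \<open>q' = \<infinity>\<close>, which forces
  \<open>q = 1\<close>, and \<open>a = 0\<close>, where \<open>g\<close> vanishes a.e.\<close>

lemma nn_integral_mult_le_Lp_norm:
  assumes q: "1 \<le> q" "q < \<infinity>" "1 / q + 1 / q' = 1"
    and [measurable]: "f \<in> borel_measurable \<mu>" "g \<in> borel_measurable \<mu>"
    and f: "Lp_norm q' \<mu> f \<le> 1" and g: "Lp_norm q \<mu> g \<le> ennreal a" and a: "0 \<le> a"
  shows "(\<integral>\<^sup>+x. ennreal \<bar>f x * g x\<bar> \<partial>\<mu>) \<le> ennreal a"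
proof (cases "q' = \<infinity>")
  case True
  then have "1 / q = 1" using q(3) by simp
  then have "q = 1"
    using q(2) by (metis divide_eq_1_ennreal infinity_ennreal_def less_irrefl one_neq_zero)
  have "esssup \<mu> (\<lambda>x. ennreal \<bar>f x\<bar>) \<le> 1"
    using f True by (simp add: Lp_norm_def)
  then have "AE x in \<mu>. ennreal \<bar>f x\<bar> \<le> 1"
    using esssup_AE[of "\<lambda>x. ennreal \<bar>f x\<bar>" \<mu>] by (metis (mono_tags, lifting) eventually_mono order.trans)
  then have "(\<integral>\<^sup>+x. ennreal \<bar>f x * g x\<bar> \<partial>\<mu>) \<le> (\<integral>\<^sup>+x. ennreal \<bar>g x\<bar> \<partial>\<mu>)"
    by (intro nn_integral_mono_AE, elim eventually_mono)
      (auto simp: abs_mult intro!: ennreal_leI mult_left_le_one_le)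
  then show ?thesis using g \<open>q = 1\<close> by (simp add: Lp_norm_one)
next
  case False
  define p s where "p = enn2real q" and "s = enn2real q'"
  have ps: "1 < p" "1 < s" "1 / p + 1 / s = 1"
    using conjugate_exponents_real[OF q(1,2) False q(3)] by (auto simp: p_def s_def)
  have f_le: "(\<integral>\<^sup>+x. ennreal (\<bar>f x\<bar> powr s) \<partial>\<mu>) \<le> 1"
    using Lp_norm_leD[of q' \<mu> f 1] f False ps by (simp add: s_def)
  have g_le: "(\<integral>\<^sup>+x. ennreal (\<bar>g x\<bar> powr p) \<partial>\<mu>) \<le> ennreal (a powr p)"
    using Lp_norm_leD[OF g a] q(2) ps by (simp add: p_def)
  show ?thesis
  proof (cases "a = 0")
    case True
    then have "(\<integral>\<^sup>+x. ennreal (\<bar>g x\<bar> powr p) \<partial>\<mu>) = 0"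
      using g_le by simp
    then have "AE x in \<mu>. ennreal (\<bar>g x\<bar> powr p) = 0"
      by (subst (asm) nn_integral_0_iff_AE) auto
    then have "AE x in \<mu>. ennreal \<bar>f x * g x\<bar> = 0"
      by eventually_elim (auto simp: ennreal_eq_0_iff)
    then have "(\<integral>\<^sup>+x. ennreal \<bar>f x * g x\<bar> \<partial>\<mu>) = 0"
      by (subst nn_integral_0_iff_AE) auto
    then show ?thesis by simp
  next
    case False
    then have a: "0 < a" using a by simp
    have "(\<integral>\<^sup>+x. ennreal \<bar>f x * g x\<bar> \<partial>\<mu>) \<le>
        (\<integral>\<^sup>+x. ennreal (a / s) * ennreal (\<bar>f x\<bar> powr s) + ennreal (a / (p * a powr p)) * ennreal (\<bar>g x\<bar> powr p) \<partial>\<mu>)"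
    proof (intro nn_integral_mono)
      fix x
      have "\<bar>f x\<bar> * (\<bar>g x\<bar> / a) \<le> \<bar>f x\<bar> powr s / s + (\<bar>g x\<bar> / a) powr p / p"
        using ps a by (intro Youngs_inequality) auto
      then have "a * (\<bar>f x\<bar> * (\<bar>g x\<bar> / a)) \<le> a * (\<bar>f x\<bar> powr s / s + (\<bar>g x\<bar> / a) powr p / p)"
        using a by (intro mult_left_mono) auto
      then have "\<bar>f x * g x\<bar> \<le> a / s * \<bar>f x\<bar> powr s + a / (p * a powr p) * \<bar>g x\<bar> powr p"
        using a by (simp add: abs_mult powr_divide distrib_left ac_simps)
      then show "ennreal \<bar>f x * g x\<bar> \<le>
          ennreal (a / s) * ennreal (\<bar>f x\<bar> powr s) + ennreal (a / (p * a powr p)) * ennreal (\<bar>g x\<bar> powr p)"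
        using a ps by (simp add: ennreal_leI flip: ennreal_mult' ennreal_plus)
    qed
    also have "\<dots> = ennreal (a / s) * (\<integral>\<^sup>+x. ennreal (\<bar>f x\<bar> powr s) \<partial>\<mu>) +
        ennreal (a / (p * a powr p)) * (\<integral>\<^sup>+x. ennreal (\<bar>g x\<bar> powr p) \<partial>\<mu>)"
      by (simp add: nn_integral_add nn_integral_cmult)
    also have "\<dots> \<le> ennreal (a / s) * 1 + ennreal (a / (p * a powr p)) * ennreal (a powr p)"
      using f_le g_le by (intro add_mono mult_left_mono) auto
    also have "\<dots> = ennreal (a / s + a / p)"
      using a ps by (simp flip: ennreal_mult' ennreal_plus)
    also have "a / s + a / p = a * (1 / p + 1 / s)" by (simp add: algebra_simps)
    finally show ?thesis by (simp add: ps)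
  qed
qed

theorem theorem2:
  fixes \<mu> :: "'x measure"
    and T :: "('d::finite \<Rightarrow> 'y::normed_lattice) \<Rightarrow> 'x \<Rightarrow> real"
    and q q' :: ennreal
    and A B :: real
    and D :: "'y set"
    and M :: "'x \<Rightarrow> real"
  assumes "sigma_finite_measure \<mu>"
    and "ae_multilinear \<mu> T"
    and "ae_multi_positive \<mu> T"
    and "ae_symmetric \<mu> T"
    and "saturates \<mu> T"
    and "1 \<le> q" and "q < \<infinity>" and "1 / q + 1 / q' = 1"
    and "0 \<le> A" and "0 \<le> B"
    and "\<And>f. 0 \<le> f \<Longrightarrow>
          Lp_norm q \<mu> (\<lambda>x. root CARD('d) (T (\<lambda>_. f) x)) \<le> ennreal (A * norm f)"
    and "dense_lattice_subspace D"
    and "\<And>f. f \<in> D \<Longrightarrow> 0 \<le> f \<Longrightarrow>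
          \<exists>S. ae_linear \<mu> S \<and> ae_positive \<mu> S \<and>
            (\<forall>hs. (\<forall>i. 0 \<le> hs i) \<longrightarrow> (AE x in \<mu>. T hs x \<le> (\<Prod>i\<in>UNIV. S (hs i) x))) \<and>
            (AE x in \<mu>. S f x ^ CARD('d) \<le> B ^ CARD('d) * T (\<lambda>_. f) x)"
    and "M \<in> borel_measurable \<mu>" and "AE x in \<mu>. 0 \<le> M x" and "Lp_norm q' \<mu> M = 1"
  shows "\<exists>R. ae_linear \<mu> R \<and> ae_positive \<mu> R \<and> (\<forall>f. integrable \<mu> (R f)) \<and>
            (\<forall>fs. (\<forall>i. 0 \<le> fs i) \<longrightarrow>
               (AE x in \<mu>. M x ^ CARD('d) * T fs x \<le> (\<Prod>i\<in>UNIV. R (fs i) x))) \<and>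
            L1_opnorm \<mu> R \<le> ennreal (A * B)"
proof -
  note [measurable] = assms(14) ae_multilinear_measurable[OF assms(2)]
  \<comment> \<open>Hoelder's inequality against the normalized \<open>M\<close> yields both
    diagonal assumptions of \<open>weighted_form\<close>.\<close>
  have diag: "(\<integral>\<^sup>+x. ennreal \<bar>M x * root CARD('d) (T (\<lambda>_. f) x)\<bar> \<partial>\<mu>) \<le> ennreal (A * norm f)"
    if "0 \<le> f" for f
  proof (rule nn_integral_mult_le_Lp_norm[OF assms(6,7,8,14)])
    show "(\<lambda>x. root CARD('d) (T (\<lambda>_. f) x)) \<in> borel_measurable \<mu>" by measurable
    show "Lp_norm q \<mu> (\<lambda>x. root CARD('d) (T (\<lambda>_. f) x)) \<le> ennreal (A * norm f)"
      using that by (rule assms(11))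
  qed (use assms(9,16) in auto)
  interpret factorizable_form \<mu> T M A B D
  proof
    fix f :: 'y assume f: "0 \<le> f"
    show "integrable \<mu> (\<lambda>x. M x * root CARD('d) (T (\<lambda>_. f) x))"
      using diag[OF f] by (intro integrableI_bounded) (auto intro: le_less_trans)
    show "(LINT x|\<mu>. M x * root CARD('d) (T (\<lambda>_. f) x)) \<le> A * norm f"
    proof (rule integral_real_bounded)
      show "(\<integral>\<^sup>+x. ennreal (M x * root CARD('d) (T (\<lambda>_. f) x)) \<partial>\<mu>) \<le> ennreal (A * norm f)"
        using diag[OF f] by (rule order.trans[rotated]) (intro nn_integral_mono ennreal_leI abs_ge_self)
    qed (use assms(9) in simp)
  qed (use assms in \<open>auto simp: dense_lattice_subspace_def\<close>)
  obtain R where R: "ae_linear \<mu> R" "ae_positive \<mu> R" "\<And>f. integrable \<mu> (R f)"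
    "\<And>fs. (\<And>i. 0 \<le> fs i) \<Longrightarrow> AE x in \<mu>. M x ^ CARD('d) * T fs x \<le> (\<Prod>i\<in>UNIV. R (fs i) x)"
    "\<And>f. (\<integral>\<^sup>+x. ennreal \<bar>R f x\<bar> \<partial>\<mu>) \<le> ennreal (A * B * norm f)"
    using factorization[OF assms(1)] by blast
  have "L1_opnorm \<mu> R \<le> ennreal (A * B)"
    unfolding L1_opnorm_def
  proof (rule SUP_least)
    fix f :: 'y assume "f \<in> {f. norm f \<le> 1}"
    then have "A * B * norm f \<le> A * B"
      using assms(9,10) by (intro mult_left_le) auto
    then show "Lp_norm 1 \<mu> (R f) \<le> ennreal (A * B)"
      using R(5)[of f] by (auto simp: Lp_norm_one intro: order.trans ennreal_leI)
  qed
  with R show ?thesis by blast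
qed

end
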